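(* Let $\dot E=(E,C,D)$ be a bi-separated graph. Let $\eta:\mathbf{ABS}(\dot E)\to\mathbf{RG}(\dot E)$ and $\theta:\mathbf{RG}(\dot E)\to\mathbf{ABS}(\dot E)$ be the functors defined in the context between the category of (saturated) $\dot E$-algebraic branching systems and the category of (not necessarily connected) representation graphs for $\dot E$. Then $\theta\circ\eta=\operatorname{id}_{\mathbf{ABS}(\dot E)}$ and $\eta\circ\theta\cong\operatorname{id}_{\mathbf{RG}(\dot E)}$. Hence the categories $\mathbf{RG}(\dot E)$ and $\mathbf{ABS}(\dot E)$ are equivalent.
   Context: A (directed) graph is a quadruple $E=(E^0,E^1,s,r)$ with sets $E^0$ (vertices), $E^1$ (edges) and maps $s,r:E^1\to E^0$. Graphs have at least one vertex. A graph homomorphism $\phi:F\to E$ is a pair of maps $\phi^0:F^0\to E^0$, $\phi^1:F^1\to E^1$ commuting with $s$ and $r$; both are written $\phi$. A bi-separated graph is a triple $\dot E=(E,C,D)$ with $E$ a graph (assumed connected, in the undirected sense), $C=\bigsqcup_{v\in E^0}C_v$ with $C_v$ a partition of $s^{-1}(v)$, $D=\bigsqcup_{v\in E^0}D_v$ with $D_v$ a partition of $r^{-1}(v)$, and $|X\cap Y|\le 1$ for all $X\in C$, $Y\in D$. All bi-separated graphs are assumed finitely bi-separated: every $X\in C$ and every $Y\in D$ is a finite set. A representation graph for $\dot E$ is a pair $(F,\phi)$ with $F$ a graph and $\phi:F\to E$ a graph homomorphism such that (i) for any $w\in F^0$ and $X\in C_{\phi(w)}$ there is precisely one $f\in s^{-1}(w)$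 with $\phi(f)\in X$; (ii) for any $w\in F^0$ and $Y\in D_{\phi(w)}$ there is precisely one $f\in r^{-1}(w)$ with $\phi(f)\in Y$. For this result the graph $F$ in a representation graph is NOT assumed to be connected. $\mathbf{RG}(\dot E)$ is the category of representation graphs; a morphism $(F,\phi)\to(G,\psi)$ is a graph homomorphism $\alpha:F\to G$ with $\psi\circ\alpha=\phi$. An $\dot E$-algebraic branching system is a tuple $(Q,\{Q_v\}_{v\in E^0},\{S_e\}_{e\in E^1},\{R_e\}_{e\in E^1},\{\rho_e\}_{e\in E^1})$ where $\{Q_v\}$ is a family of pairwise disjoint subsets of a nonempty set $Q$; $\{S_e\}$ is a family of sets such that $Q_v=\bigsqcup_{e\in X}S_e$ for any $v\in E^0$, $X\in C_v$; $\{R_e\}$ is a family of sets such that $Q_v=\bigsqcup_{e\in Y}R_e$ for any $v\in E^0$, $Y\in D_v$; and each $\rho_e:S_e\to R_e$ is a bijection. All $\dot E$-algebraic branching systems are assumed saturated: $Q=\bigcup_{v\in E^0}Q_v$. In the category $\mathbf{ABS}(\dot E)$ a morphism from $(Q,\{Q_v\},\{S_e\},\{R_e\},\{\rho_e\})$ to $(Q',\{Q'_v\},\{S'_e\},\{R'_e\},\{\rho'_e\})$ is a map $\alpha:Q\to Q'$ with $\alpha(Q_v)\subseteq Q'_v$, $\alpha(S_e)\subseteq S'_e$, $\alpha(R_e)\subseteq R'_e$ for all $v,e$, compatible with the bijections, i.e. $\alpha(\rho_e(q))=\rho'_e(\alpha(q))$ for $q\in S_e$. The functor $\eta$. For $\mathcal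 S=(Q,\{Q_v\},\{S_e\},\{R_e\},\{\rho_e\})$, $\eta(\mathcal S)=(F,\phi)$ with $F^0=Q$, $F^1=\{f_{q,X}\mid q\in Q_v,\ X\in C_v\text{ for some }v\in E^0\}$, $s(f_{q,X})=q$, $r(f_{q,X})=\rho_e(q)$ and $\phi^1(f_{q,X})=e$ where $e$ is the element of $X$ with $q\in S_e$, and $\phi^0(q)=v$ if $q\in Q_v$. For a morphism $\alpha$, $\eta(\alpha)^0(q)=\alpha(q)$ and $\eta(\alpha)^1(f_{q,X})=f'_{\alpha(q),X}$. The functor $\theta$. For $(F,\phi)$, $\theta(F,\phi)=(Q,\{Q_v\},\{S_e\},\{R_e\},\{\rho_e\})$ with $Q=F^0$, $Q_v=\{w\in F^0\mid\phi(w)=v\}$, $S_e=\{w\in F^0\mid\exists f\in s^{-1}(w):\phi(f)=e\}$, $R_e=\{w\in F^0\mid\exists f\in r^{-1}(w):\phi(f)=e\}$, and $\rho_e(w)=r(f)$ for $w\in S_e$, where $f\in s^{-1}(w)$ is the edge with $\phi(f)=e$. For a morphism $\alpha$, $\theta(\alpha)(q)=\alpha(q)$ for $q\in F^0$. *)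

theory Defs
  imports "Graph_Theory.Digraph_Component" "HOL-Library.FuncSet" "HOL-Library.Disjoint_Sets"
begin

section \<open>Categories, functors, equivalences\<close>

text \<open>
  Hom-sets are indexed by domain and codomain and need not be disjoint; hence composition, and the
  action of a functor on morphisms, take the objects involved as arguments:
  \<open>Comp A X Y Z g f\<close> is the composite of \<open>f : X \<rightarrow> Y\<close> and \<open>g : Y \<rightarrow> Z\<close>.
\<close>

record ('o, 'm) cat =
  Ob :: "'o set"
  Hom :: "'o \<Rightarrow> 'o \<Rightarrow> 'm set"
  Idn :: "'o \<Rightarrow> 'm"
  Comp :: "'o \<Rightarrow> 'o \<Rightarrow> 'o \<Rightarrow> 'm \<Rightarrow> 'm \<Rightarrow> 'm"

definition is_category :: "('o, 'm) cat \<Rightarrow> bool" where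
  "is_category A \<longleftrightarrow>
     (\<forall>X\<in>Ob A. Idn A X \<in> Hom A X X) \<and>
     (\<forall>X\<in>Ob A. \<forall>Y\<in>Ob A. \<forall>Z\<in>Ob A. \<forall>f\<in>Hom A X Y. \<forall>g\<in>Hom A Y Z.
        Comp A X Y Z g f \<in> Hom A X Z) \<and>
     (\<forall>X\<in>Ob A. \<forall>Y\<in>Ob A. \<forall>f\<in>Hom A X Y.
        Comp A X X Y f (Idn A X) = f \<and> Comp A X Y Y (Idn A Y) f = f) \<and>
     (\<forall>W\<in>Ob A. \<forall>X\<in>Ob A. \<forall>Y\<in>Ob A. \<forall>Z\<in>Ob A.
        \<forall>f\<in>Hom A W X. \<forall>g\<in>Hom A X Y. \<forall>h\<in>Hom A Y Z.
          Comp A W Y Z h (Comp A W X Y g f) = Comp A W X Z (Comp A X Y Z h g) f)"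

record ('o, 'm, 'p, 'n) cat_functor =
  FOb :: "'o \<Rightarrow> 'p"
  FMor :: "'o \<Rightarrow> 'o \<Rightarrow> 'm \<Rightarrow> 'n"

definition is_functor ::
    "('o, 'm) cat \<Rightarrow> ('p, 'n) cat \<Rightarrow> ('o, 'm, 'p, 'n) cat_functor \<Rightarrow> bool" where
  "is_functor A B F \<longleftrightarrow>
     (\<forall>X\<in>Ob A. FOb F X \<in> Ob B) \<and>
     (\<forall>X\<in>Ob A. \<forall>Y\<in>Ob A. \<forall>f\<in>Hom A X Y. FMor F X Y f \<in> Hom B (FOb F X) (FOb F Y)) \<and>
     (\<forall>X\<in>Ob A. FMor F X X (Idn A X) = Idn B (FOb F X)) \<and>
     (\<forall>X\<in>Ob A. \<forall>Y\<in>Ob A. \<forall>Z\<in>Ob A. \<forall>f\<in>Hom A X Y. \<forall>g\<in>Hom A Y Z.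
        FMor F X Z (Comp A X Y Z g f) =
          Comp B (FOb F X) (FOb F Y) (FOb F Z) (FMor F Y Z g) (FMor F X Y f))"

definition id_functor :: "('o, 'm, 'o, 'm) cat_functor" where
  "id_functor = \<lparr>FOb = (\<lambda>X. X), FMor = (\<lambda>X Y f. f)\<rparr>"

definition comp_functor ::
    "('p, 'n, 'r, 'l) cat_functor \<Rightarrow> ('o, 'm, 'p, 'n) cat_functor \<Rightarrow> ('o, 'm, 'r, 'l) cat_functor"
    (infixl "\<circ>\<^sub>F" 55) where
  "G \<circ>\<^sub>F F = \<lparr>FOb = (\<lambda>X. FOb G (FOb F X)),
             FMor = (\<lambda>X Y f. FMor G (FOb F X) (FOb F Y) (FMor F X Y f))\<rparr>"

text \<open>Equality of functors on the category \<open>A\<close>; values outside \<open>A\<close> are irrelevant.\<close>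

definition functor_eq_on ::
    "('o, 'm) cat \<Rightarrow> ('o, 'm, 'p, 'n) cat_functor \<Rightarrow> ('o, 'm, 'p, 'n) cat_functor \<Rightarrow> bool" where
  "functor_eq_on A F G \<longleftrightarrow>
     (\<forall>X\<in>Ob A. FOb F X = FOb G X) \<and>
     (\<forall>X\<in>Ob A. \<forall>Y\<in>Ob A. \<forall>f\<in>Hom A X Y. FMor F X Y f = FMor G X Y f)"

definition is_iso :: "('o, 'm) cat \<Rightarrow> 'o \<Rightarrow> 'o \<Rightarrow> 'm \<Rightarrow> bool" where
  "is_iso A X Y f \<longleftrightarrow> f \<in> Hom A X Y \<and>
     (\<exists>g\<in>Hom A Y X. Comp A X Y X g f = Idn A X \<and> Comp A Y X Y f g = Idn A Y)"

definition naturally_isomorphic ::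
    "('o, 'm) cat \<Rightarrow> ('p, 'n) cat \<Rightarrow>
     ('o, 'm, 'p, 'n) cat_functor \<Rightarrow> ('o, 'm, 'p, 'n) cat_functor \<Rightarrow> bool" where
  "naturally_isomorphic A B F G \<longleftrightarrow>
     is_functor A B F \<and> is_functor A B G \<and>
     (\<exists>t. (\<forall>X\<in>Ob A. is_iso B (FOb F X) (FOb G X) (t X)) \<and>
          (\<forall>X\<in>Ob A. \<forall>Y\<in>Ob A. \<forall>f\<in>Hom A X Y.
             Comp B (FOb F X) (FOb F Y) (FOb G Y) (t Y) (FMor F X Y f) =
             Comp B (FOb F X) (FOb G X) (FOb G Y) (FMor G X Y f) (t X)))"

definition equivalent_categories :: "('o, 'm) cat \<Rightarrow> ('p, 'n) cat \<Rightarrow> bool" where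
  "equivalent_categories A B \<longleftrightarrow> is_category A \<and> is_category B \<and>
     (\<exists>F G. is_functor A B F \<and> is_functor B A G \<and>
        naturally_isomorphic A A (G \<circ>\<^sub>F F) id_functor \<and>
        naturally_isomorphic B B (F \<circ>\<^sub>F G) id_functor)"


section \<open>Bi-separated graphs\<close>

text \<open>
  Of the families \<open>C\<close> and \<open>D\<close>, only the members \<open>C v\<close> and \<open>D v\<close> with \<open>v \<in> verts E\<close> matter.
  The predicate \<open>connected\<close> refers to the underlying undirected graph and implies
  \<open>verts E \<noteq> {}\<close>.
\<close>

definition bi_separated_graph ::
    "('v, 'e) pre_digraph \<Rightarrow> ('v \<Rightarrow> 'e set set) \<Rightarrow> ('v \<Rightarrow> 'e set set) \<Rightarrow> bool" where
  "bi_separated_graph E C D \<longleftrightarrow>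
     wf_digraph E \<and> connected E \<and>
     (\<forall>v\<in>verts E. partition_on (out_arcs E v) (C v)) \<and>
     (\<forall>v\<in>verts E. partition_on (in_arcs E v) (D v)) \<and>
     (\<forall>v\<in>verts E. \<forall>X\<in>C v. finite X) \<and>
     (\<forall>v\<in>verts E. \<forall>Y\<in>D v. finite Y) \<and>
     (\<forall>v\<in>verts E. \<forall>u\<in>verts E. \<forall>X\<in>C v. \<forall>Y\<in>D u. card (X \<inter> Y) \<le> 1)"


section \<open>Representation graphs\<close>

text \<open>
  All functions occurring in objects and morphisms below are required to be extensional, so that
  HOL equality of objects and of morphisms is equality of the mathematical data.
\<close>

type_synonym ('v, 'e, 'w, 'g) graph_map = "('v \<Rightarrow> 'w) \<times> ('e \<Rightarrow> 'g)"

definition graph_hom ::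
    "('v, 'e) pre_digraph \<Rightarrow> ('w, 'g) pre_digraph \<Rightarrow> ('v, 'e, 'w, 'g) graph_map \<Rightarrow> bool" where
  "graph_hom F E \<phi> \<longleftrightarrow>
     fst \<phi> \<in> verts F \<rightarrow>\<^sub>E verts E \<and> snd \<phi> \<in> arcs F \<rightarrow>\<^sub>E arcs E \<and>
     (\<forall>g\<in>arcs F. tail E (snd \<phi> g) = fst \<phi> (tail F g) \<and> head E (snd \<phi> g) = fst \<phi> (head F g))"

definition graph_map_comp ::
    "('v, 'e) pre_digraph \<Rightarrow> ('w, 'g, 'x, 'h) graph_map \<Rightarrow> ('v, 'e, 'w, 'g) graph_map \<Rightarrow>
     ('v, 'e, 'x, 'h) graph_map" where
  "graph_map_comp F \<beta> \<alpha> =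
     (compose (verts F) (fst \<beta>) (fst \<alpha>), compose (arcs F) (snd \<beta>) (snd \<alpha>))"

type_synonym ('v, 'e, 'q, 'f) rep_graph = "('q, 'f) pre_digraph \<times> ('q, 'f, 'v, 'e) graph_map"

definition representation_graph ::
    "('v, 'e) pre_digraph \<Rightarrow> ('v \<Rightarrow> 'e set set) \<Rightarrow> ('v \<Rightarrow> 'e set set) \<Rightarrow>
     ('v, 'e, 'q, 'f) rep_graph \<Rightarrow> bool" where
  "representation_graph E C D = (\<lambda>(F, \<phi>).
     wf_digraph F \<and> verts F \<noteq> {} \<and>
     tail F \<in> extensional (arcs F) \<and> head F \<in> extensional (arcs F) \<and>
     graph_hom F E \<phi> \<and>
     (\<forall>w\<in>verts F. \<forall>X\<in>C (fst \<phi> w). \<exists>!g. g \<in> out_arcs F w \<and> snd \<phi> g \<in> X) \<and>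
     (\<forall>w\<in>verts F. \<forall>Y\<in>D (fst \<phi> w). \<exists>!g. g \<in> in_arcs F w \<and> snd \<phi> g \<in> Y))"

definition RG ::
    "('v, 'e) pre_digraph \<Rightarrow> ('v \<Rightarrow> 'e set set) \<Rightarrow> ('v \<Rightarrow> 'e set set) \<Rightarrow>
     (('v, 'e, 'q, 'f) rep_graph, ('q, 'f, 'q, 'f) graph_map) cat" where
  "RG E C D =
     \<lparr>Ob = {F. representation_graph E C D F},
      Hom = (\<lambda>(F, \<phi>) (G, \<psi>). {\<alpha>. graph_hom F G \<alpha> \<and> graph_map_comp F \<psi> \<alpha> = \<phi>}),
      Idn = (\<lambda>(F, \<phi>). (\<lambda>w\<in>verts F. w, \<lambda>g\<in>arcs F. g)),
      Comp = (\<lambda>(F, \<phi>) _ _ \<beta> \<alpha>. graph_map_comp F \<beta> \<alpha>)\<rparr>"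


section \<open>Algebraic branching systems\<close>

record ('v, 'e, 'q) branching_system =
  space :: "'q set"
  Qs :: "'v \<Rightarrow> 'q set"
  Ss :: "'e \<Rightarrow> 'q set"
  Rs :: "'e \<Rightarrow> 'q set"
  rho :: "'e \<Rightarrow> 'q \<Rightarrow> 'q"

definition algebraic_branching_system ::
    "('v, 'e) pre_digraph \<Rightarrow> ('v \<Rightarrow> 'e set set) \<Rightarrow> ('v \<Rightarrow> 'e set set) \<Rightarrow>
     ('v, 'e, 'q) branching_system \<Rightarrow> bool" where
  "algebraic_branching_system E C D S \<longleftrightarrow>
     space S \<noteq> {} \<and>
     Qs S \<in> extensional (verts E) \<and> Ss S \<in> extensional (arcs E) \<and>
     Rs S \<in> extensional (arcs E) \<and> rho S \<in> extensional (arcs E) \<and>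
     disjoint_family_on (Qs S) (verts E) \<and>
     space S = (\<Union>v\<in>verts E. Qs S v) \<and>
     (\<forall>v\<in>verts E. \<forall>X\<in>C v. Qs S v = (\<Union>e\<in>X. Ss S e) \<and> disjoint_family_on (Ss S) X) \<and>
     (\<forall>v\<in>verts E. \<forall>Y\<in>D v. Qs S v = (\<Union>e\<in>Y. Rs S e) \<and> disjoint_family_on (Rs S) Y) \<and>
     (\<forall>e\<in>arcs E. rho S e \<in> extensional (Ss S e) \<and> bij_betw (rho S e) (Ss S e) (Rs S e))"

definition ABS ::
    "('v, 'e) pre_digraph \<Rightarrow> ('v \<Rightarrow> 'e set set) \<Rightarrow> ('v \<Rightarrow> 'e set set) \<Rightarrow>
     (('v, 'e, 'q) branching_system, 'q \<Rightarrow> 'q) cat" where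
  "ABS E C D =
     \<lparr>Ob = {S. algebraic_branching_system E C D S},
      Hom = (\<lambda>S T. {\<alpha>. \<alpha> \<in> space S \<rightarrow>\<^sub>E space T \<and>
                (\<forall>v\<in>verts E. \<alpha> ` Qs S v \<subseteq> Qs T v) \<and>
                (\<forall>e\<in>arcs E. \<alpha> ` Ss S e \<subseteq> Ss T e) \<and>
                (\<forall>e\<in>arcs E. \<alpha> ` Rs S e \<subseteq> Rs T e) \<and>
                (\<forall>e\<in>arcs E. \<forall>q\<in>Ss S e. \<alpha> (rho S e q) = rho T e (\<alpha> q))}),
      Idn = (\<lambda>S. \<lambda>q\<in>space S. q),
      Comp = (\<lambda>S _ _ \<beta> \<alpha>. compose (space S) \<beta> \<alpha>)\<rparr>"


section \<open>The functors \<open>\<eta>\<close> and \<open>\<theta>\<close>\<close>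

text \<open>
  The edges of \<open>\<eta>(S)\<close> are formal symbols \<open>f\<^bsub>q,X\<^esub>\<close>. In order that \<open>\<eta>\<close> lands in the category of
  representation graphs with edges in a given type \<open>'f\<close>, the elements of \<open>'f\<close> serving as these
  symbols are a parameter \<open>f :: 'q \<Rightarrow> 'e set \<Rightarrow> 'f\<close>, subject to the requirement that distinct
  pairs \<open>(q, X)\<close> have distinct symbols. On a type \<open>'g + 'q \<times> 'e set\<close>, with \<open>'g\<close> arbitrary, one may
  take \<open>f q X = Inr (q, X)\<close>.
\<close>

definition edge_symbols ::
    "('v, 'e) pre_digraph \<Rightarrow> ('v \<Rightarrow> 'e set set) \<Rightarrow> ('q \<Rightarrow> 'e set \<Rightarrow> 'f) \<Rightarrow> bool" where
  "edge_symbols E C f \<longleftrightarrow> inj_on (\<lambda>(q, X). f q X) (UNIV \<times> (\<Union>v\<in>verts E. C v))"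

definition eta_index ::
    "('v, 'e) pre_digraph \<Rightarrow> ('v \<Rightarrow> 'e set set) \<Rightarrow> ('v, 'e, 'q) branching_system \<Rightarrow>
     ('q \<times> 'e set) set" where
  "eta_index E C S = {(q, X). \<exists>v\<in>verts E. q \<in> Qs S v \<and> X \<in> C v}"

definition eta_arcs ::
    "('v, 'e) pre_digraph \<Rightarrow> ('v \<Rightarrow> 'e set set) \<Rightarrow> ('q \<Rightarrow> 'e set \<Rightarrow> 'f) \<Rightarrow>
     ('v, 'e, 'q) branching_system \<Rightarrow> 'f set" where
  "eta_arcs E C f S = (\<lambda>(q, X). f q X) ` eta_index E C S"

text \<open>The pair \<open>(q, X)\<close> named by a symbol \<open>f\<^bsub>q,X\<^esub>\<close>.\<close>

definition eta_decode ::
    "('v, 'e) pre_digraph \<Rightarrow> ('v \<Rightarrow> 'e set set) \<Rightarrow> ('q \<Rightarrow> 'e set \<Rightarrow> 'f) \<Rightarrow>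
     ('v, 'e, 'q) branching_system \<Rightarrow> 'f \<Rightarrow> 'q \<times> 'e set" where
  "eta_decode E C f S = inv_into (eta_index E C S) (\<lambda>(q, X). f q X)"

definition eta_label :: "('v, 'e, 'q) branching_system \<Rightarrow> 'q \<Rightarrow> 'e set \<Rightarrow> 'e" where
  "eta_label S q X = (THE e. e \<in> X \<and> q \<in> Ss S e)"

definition eta_ob ::
    "('v, 'e) pre_digraph \<Rightarrow> ('v \<Rightarrow> 'e set set) \<Rightarrow> ('q \<Rightarrow> 'e set \<Rightarrow> 'f) \<Rightarrow>
     ('v, 'e, 'q) branching_system \<Rightarrow> ('v, 'e, 'q, 'f) rep_graph" where
  "eta_ob E C f S =
     (\<lparr>verts = space S,
       arcs = eta_arcs E C f S,
       tail = (\<lambda>a\<in>eta_arcs E C f S. let (q, X) = eta_decode E C f S a in q),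
       head = (\<lambda>a\<in>eta_arcs E C f S. let (q, X) = eta_decode E C f S a in rho S (eta_label S q X) q)\<rparr>,
      (\<lambda>q\<in>space S. THE v. v \<in> verts E \<and> q \<in> Qs S v,
       \<lambda>a\<in>eta_arcs E C f S. let (q, X) = eta_decode E C f S a in eta_label S q X))"

definition eta ::
    "('v, 'e) pre_digraph \<Rightarrow> ('v \<Rightarrow> 'e set set) \<Rightarrow> ('q \<Rightarrow> 'e set \<Rightarrow> 'f) \<Rightarrow>
     (('v, 'e, 'q) branching_system, 'q \<Rightarrow> 'q,
      ('v, 'e, 'q, 'f) rep_graph, ('q, 'f, 'q, 'f) graph_map) cat_functor" where
  "eta E C f =
     \<lparr>FOb = eta_ob E C f,
      FMor = (\<lambda>S T \<alpha>. (\<lambda>q\<in>space S. \<alpha> q,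
         \<lambda>a\<in>eta_arcs E C f S. let (q, X) = eta_decode E C f S a in f (\<alpha> q) X))\<rparr>"

definition theta_ob ::
    "('v, 'e) pre_digraph \<Rightarrow> ('v, 'e, 'q, 'f) rep_graph \<Rightarrow> ('v, 'e, 'q) branching_system" where
  "theta_ob E = (\<lambda>(F, \<phi>).
     let S = (\<lambda>e. {w \<in> verts F. \<exists>g\<in>out_arcs F w. snd \<phi> g = e});
         R = (\<lambda>e. {w \<in> verts F. \<exists>g\<in>in_arcs F w. snd \<phi> g = e})
     in \<lparr>space = verts F,
         Qs = (\<lambda>v\<in>verts E. {w \<in> verts F. fst \<phi> w = v}),
         Ss = (\<lambda>e\<in>arcs E. S e),
         Rs = (\<lambda>e\<in>arcs E. R e),
         rho = (\<lambda>e\<in>arcs E. \<lambda>w\<in>S e. head F (THE g. g \<in> out_arcs F w \<and> snd \<phi> g = e))\<rparr>)"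

definition theta ::
    "('v, 'e) pre_digraph \<Rightarrow>
     (('v, 'e, 'q, 'f) rep_graph, ('q, 'f, 'q, 'f) graph_map,
      ('v, 'e, 'q) branching_system, 'q \<Rightarrow> 'q) cat_functor" where
  "theta E =
     \<lparr>FOb = theta_ob E,
      FMor = (\<lambda>(F, \<phi>) (G, \<psi>) \<alpha>. \<lambda>q\<in>verts F. fst \<alpha> q)\<rparr>"

end

theory Submission
  imports Defs
begin

text \<open>
  In a representation graph \<open>(F, \<phi>)\<close> an arc is determined by its tail \<open>w\<close> and its label \<open>e\<close>: the
  label lies in some cell \<open>X\<close> of \<open>C\<close>, and condition (i) allows only one arc at \<open>w\<close> with label in
  \<open>X\<close>. So the arcs with label \<open>e\<close> form the graph of a function on the set \<open>S\<^sub>e\<close> of their tails, which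
  is injective by condition (ii); this function is \<open>\<rho>\<^sub>e\<close>. A branching system thus records the
  vertices of a representation graph together with, for each label, the set of arcs as a bijection
  between sets of vertices; only the names of the arcs are lost.

  Formally, \<open>\<theta>\<close> is fully faithful: a morphism of representation graphs is determined by its vertex
  map (\<open>RG_hom_eqI\<close>), and every morphism \<open>\<theta>(F, \<phi>) \<rightarrow> \<theta>(G, \<psi>)\<close> is such a vertex map
  (\<open>theta_full\<close>). Moreover \<open>\<theta>(\<eta>(S)) = S\<close> (\<open>theta_eta_ob\<close>). The rest rests on these facts. Since
  \<open>\<theta>(\<eta>(\<theta>(F))) = \<theta>(F)\<close>, the identity of this object lifts to a pair of mutually inverse morphisms
  between \<open>\<eta>(\<theta>(F))\<close> and \<open>F\<close> (\<open>iso_if_theta_ob_eq\<close>). Equations between morphisms of representation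
  graphs, namely the functor laws of \<open>\<eta>\<close> and the naturality of these isomorphisms, need to be
  compared on vertices only, where \<open>\<eta>(\<alpha>)\<close> is \<open>\<alpha>\<close> and the isomorphisms are identities.
\<close>


section \<open>Functors that agree\<close>

lemma is_functor_id: "is_functor A A id_functor"
  by (simp add: is_functor_def id_functor_def)

lemma is_functor_comp:
  assumes "is_functor A B F" "is_functor B K G"
  shows "is_functor A K (G \<circ>\<^sub>F F)"
  using assms unfolding is_functor_def comp_functor_def by simp

lemma naturally_isomorphic_if_functor_eq_on:
  assumes B: "is_category B" and F: "is_functor A B F" and G: "is_functor A B G"
    and eq: "functor_eq_on A F G"
  shows "naturally_isomorphic A B F G"
proof -
  have ob: "FOb F X = FOb G X" "FOb G X \<in> Ob B" if "X \<in> Ob A" for X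
    using eq G that by (auto simp: functor_eq_on_def is_functor_def)
  have mor: "FMor F X Y h = FMor G X Y h" "FMor G X Y h \<in> Hom B (FOb G X) (FOb G Y)"
    if "X \<in> Ob A" "Y \<in> Ob A" "h \<in> Hom A X Y" for X Y h
    using eq G that by (auto simp: functor_eq_on_def is_functor_def)
  have idn: "Idn B X \<in> Hom B X X" if "X \<in> Ob B" for X
    using B that by (simp add: is_category_def)
  have unit: "Comp B X X Y h (Idn B X) = h" "Comp B X Y Y (Idn B Y) h = h"
    if "X \<in> Ob B" "Y \<in> Ob B" "h \<in> Hom B X Y" for X Y h
    using B that by (simp_all add: is_category_def)
  have "is_iso B (FOb F X) (FOb G X) (Idn B (FOb G X))" if "X \<in> Ob A" for X
    unfolding is_iso_def using ob[OF that] idn unit by metis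
  moreover have "Comp B (FOb F X) (FOb F Y) (FOb G Y) (Idn B (FOb G Y)) (FMor F X Y h) =
      Comp B (FOb F X) (FOb G X) (FOb G Y) (FMor G X Y h) (Idn B (FOb G X))"
    if "X \<in> Ob A" "Y \<in> Ob A" "h \<in> Hom A X Y" for X Y h
    using that by (simp add: ob mor unit)
  ultimately show ?thesis
    using F G unfolding naturally_isomorphic_def
    by (intro conjI exI[of _ "\<lambda>X. Idn B (FOb G X)"]) auto
qed


section \<open>Cells of a bi-separated graph\<close>

locale bi_separated =
  fixes E :: "('v, 'e) pre_digraph" and C D :: "'v \<Rightarrow> 'e set set"
  assumes bi_separated: "bi_separated_graph E C D"
begin

lemma tail_in_verts_E: "e \<in> arcs E \<Longrightarrow> tail E e \<in> verts E"
  and head_in_verts_E: "e \<in> arcs E \<Longrightarrow> head E e \<in> verts E"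
  using bi_separated by (auto simp: bi_separated_graph_def wf_digraph_def)

lemma C_partition: "v \<in> verts E \<Longrightarrow> partition_on (out_arcs E v) (C v)"
  and D_partition: "v \<in> verts E \<Longrightarrow> partition_on (in_arcs E v) (D v)"
  using bi_separated by (auto simp: bi_separated_graph_def)

lemma C_cell:
  assumes "v \<in> verts E" "X \<in> C v" "e \<in> X"
  shows "e \<in> arcs E" "tail E e = v"
  using partition_onD1[OF C_partition[OF assms(1)]] assms by (auto simp: set_eq_iff)

lemma D_cell:
  assumes "v \<in> verts E" "Y \<in> D v" "e \<in> Y"
  shows "e \<in> arcs E" "head E e = v"
  using partition_onD1[OF D_partition[OF assms(1)]] assms by (auto simp: set_eq_iff)

lemma C_cell_ex:
  assumes "e \<in> arcs E" obtains X where "X \<in> C (tail E e)" "e \<in> X"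
proof -
  have "e \<in> out_arcs E (tail E e)" using assms by simp
  then show ?thesis
    using partition_onD1[OF C_partition[OF tail_in_verts_E[OF assms]]] that by auto
qed

lemma D_cell_ex:
  assumes "e \<in> arcs E" obtains Y where "Y \<in> D (head E e)" "e \<in> Y"
proof -
  have "e \<in> in_arcs E (head E e)" using assms by simp
  then show ?thesis
    using partition_onD1[OF D_partition[OF head_in_verts_E[OF assms]]] that by auto
qed

lemma C_cell_unique:
  assumes "v \<in> verts E" "X \<in> C v" "X' \<in> C v" "e \<in> X" "e \<in> X'"
  shows "X = X'"
  using partition_onD2[OF C_partition[OF assms(1)]] assms by (auto dest: disjointD)


section \<open>The category of representation graphs\<close>

context
  fixes F :: "('q, 'f) pre_digraph" and \<phi> :: "('q, 'f, 'v, 'e) graph_map"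
  assumes rep: "representation_graph E C D (F, \<phi>)"
begin

lemma rep_verts:
  "verts F \<noteq> {}" "g \<in> arcs F \<Longrightarrow> tail F g \<in> verts F" "g \<in> arcs F \<Longrightarrow> head F g \<in> verts F"
  using rep by (auto simp: representation_graph_def wf_digraph_def)

lemma rep_graph_hom: "graph_hom F E \<phi>"
  using rep by (auto simp: representation_graph_def)

lemma rep_map:
  "w \<in> verts F \<Longrightarrow> fst \<phi> w \<in> verts E"
  "g \<in> arcs F \<Longrightarrow> snd \<phi> g \<in> arcs E"
  "g \<in> arcs F \<Longrightarrow> tail E (snd \<phi> g) = fst \<phi> (tail F g)"
  "g \<in> arcs F \<Longrightarrow> head E (snd \<phi> g) = fst \<phi> (head F g)"
  using rep_graph_hom by (auto simp: graph_hom_def)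

lemma rep_out_ex:
  assumes "w \<in> verts F" "X \<in> C (fst \<phi> w)"
  obtains g where "g \<in> arcs F" "tail F g = w" "snd \<phi> g \<in> X"
proof -
  have "\<exists>!g. g \<in> out_arcs F w \<and> snd \<phi> g \<in> X"
    using rep assms by (auto simp: representation_graph_def)
  then show ?thesis using that by auto
qed

lemma rep_in_ex:
  assumes "w \<in> verts F" "Y \<in> D (fst \<phi> w)"
  obtains g where "g \<in> arcs F" "head F g = w" "snd \<phi> g \<in> Y"
proof -
  have "\<exists>!g. g \<in> in_arcs F w \<and> snd \<phi> g \<in> Y"
    using rep assms by (auto simp: representation_graph_def)
  then show ?thesis using that by auto
qed

lemma rep_out_unique_cell:
  assumes "g \<in> arcs F" "h \<in> arcs F" "tail F g = tail F h"
    "X \<in> C (fst \<phi> (tail F g))" "snd \<phi> g \<in> X" "snd \<phi> h \<in> X"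
  shows "g = h"
proof -
  have "\<exists>!k. k \<in> out_arcs F (tail F g) \<and> snd \<phi> k \<in> X"
    using rep assms rep_verts(2) by (auto simp: representation_graph_def)
  then show ?thesis using assms by auto
qed

lemma rep_in_unique_cell:
  assumes "g \<in> arcs F" "h \<in> arcs F" "head F g = head F h"
    "Y \<in> D (fst \<phi> (head F g))" "snd \<phi> g \<in> Y" "snd \<phi> h \<in> Y"
  shows "g = h"
proof -
  have "\<exists>!k. k \<in> in_arcs F (head F g) \<and> snd \<phi> k \<in> Y"
    using rep assms rep_verts(3) by (auto simp: representation_graph_def)
  then show ?thesis using assms by auto
qed

lemma rep_out_unique:
  assumes "g \<in> arcs F" "h \<in> arcs F" "tail F g = tail F h" "snd \<phi> g = snd \<phi> h"
  shows "g = h"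
proof -
  obtain X where "X \<in> C (tail E (snd \<phi> g))" "snd \<phi> g \<in> X"
    using C_cell_ex rep_map(2)[OF assms(1)] by blast
  then show ?thesis using rep_out_unique_cell assms rep_map(3) by metis
qed

lemma rep_in_unique:
  assumes "g \<in> arcs F" "h \<in> arcs F" "head F g = head F h" "snd \<phi> g = snd \<phi> h"
  shows "g = h"
proof -
  obtain Y where "Y \<in> D (head E (snd \<phi> g))" "snd \<phi> g \<in> Y"
    using D_cell_ex rep_map(2)[OF assms(1)] by blast
  then show ?thesis using rep_in_unique_cell assms rep_map(4) by metis
qed

lemma RG_hom_iff:
  "\<alpha> \<in> Hom (RG E C D) (F, \<phi>) (G, \<psi>) \<longleftrightarrow>
     graph_hom F G \<alpha> \<and> (\<forall>w\<in>verts F. fst \<psi> (fst \<alpha> w) = fst \<phi> w) \<and>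
     (\<forall>g\<in>arcs F. snd \<psi> (snd \<alpha> g) = snd \<phi> g)"
proof -
  have "fst \<phi> \<in> extensional (verts F)" "snd \<phi> \<in> extensional (arcs F)"
    using rep_graph_hom by (auto simp: graph_hom_def PiE_def)
  then have "graph_map_comp F \<psi> \<alpha> = \<phi> \<longleftrightarrow>
      (\<forall>w\<in>verts F. fst \<psi> (fst \<alpha> w) = fst \<phi> w) \<and> (\<forall>g\<in>arcs F. snd \<psi> (snd \<alpha> g) = snd \<phi> g)"
    unfolding graph_map_comp_def prod_eq_iff fst_conv snd_conv compose_def
    by (auto simp: extensional_def fun_eq_iff restrict_def)
  then show ?thesis by (simp add: RG_def)
qed

end

text \<open>A morphism of representation graphs sends an arc \<open>g\<close> to an arc with tail and label prescribed
  by the vertex map, and by condition (i) there is only one such arc. Hence \<open>\<theta>\<close>, which keeps only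
  the vertex map, is faithful, and equations between morphisms may be checked on vertices.\<close>

lemma RG_hom_eqI:
  assumes F: "representation_graph E C D (F, \<phi>)" and G: "representation_graph E C D (G, \<psi>)"
    and \<alpha>: "\<alpha> \<in> Hom (RG E C D) (F, \<phi>) (G, \<psi>)" and \<beta>: "\<beta> \<in> Hom (RG E C D) (F, \<phi>) (G, \<psi>)"
    and eq: "\<And>w. w \<in> verts F \<Longrightarrow> fst \<alpha> w = fst \<beta> w"
  shows "\<alpha> = \<beta>"
proof -
  note a = \<alpha>[unfolded RG_hom_iff[OF F] graph_hom_def] and b = \<beta>[unfolded RG_hom_iff[OF F] graph_hom_def]
  have "snd \<alpha> g = snd \<beta> g" if "g \<in> arcs F" for g
    using a b that eq[of "tail F g"] rep_verts(2)[OF F that]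
    by (intro rep_out_unique[OF G]) auto
  then have "snd \<alpha> = snd \<beta>" using a b by (intro PiE_ext[of _ "arcs F" "\<lambda>_. arcs G"]) auto
  moreover have "fst \<alpha> = fst \<beta>" using a b eq by (intro PiE_ext[of _ "verts F" "\<lambda>_. verts G"]) auto
  ultimately show ?thesis by (simp add: prod_eq_iff)
qed

lemma RG_Idn:
  assumes F: "representation_graph E C D (F, \<phi>)"
  shows "Idn (RG E C D) (F, \<phi>) \<in> Hom (RG E C D) (F, \<phi>) (F, \<phi>)"
  unfolding RG_hom_iff[OF F] using rep_verts[OF F] by (auto simp: RG_def graph_hom_def)

lemma RG_Comp:
  assumes F: "representation_graph E C D (F, \<phi>)" and G: "representation_graph E C D (G, \<psi>)"
    and \<alpha>: "\<alpha> \<in> Hom (RG E C D) (F, \<phi>) (G, \<psi>)" and \<beta>: "\<beta> \<in> Hom (RG E C D) (G, \<psi>) (H, \<chi>)"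
  shows "Comp (RG E C D) (F, \<phi>) Y Z \<beta> \<alpha> \<in> Hom (RG E C D) (F, \<phi>) (H, \<chi>)"
proof -
  note a = \<alpha>[unfolded RG_hom_iff[OF F] graph_hom_def] and b = \<beta>[unfolded RG_hom_iff[OF G] graph_hom_def]
  have "fst \<alpha> w \<in> verts G" if "w \<in> verts F" for w using a that by auto
  moreover have "snd \<alpha> g \<in> arcs G" if "g \<in> arcs F" for g using a that by auto
  ultimately show ?thesis using a b rep_verts[OF F]
    unfolding RG_hom_iff[OF F]
    by (auto simp: RG_def graph_hom_def graph_map_comp_def compose_def)
qed

lemma fst_RG_Idn: "w \<in> verts F \<Longrightarrow> fst (Idn (RG E C D) (F, \<phi>)) w = w"
  by (simp add: RG_def)

lemma fst_RG_Comp: "w \<in> verts F \<Longrightarrow> fst (Comp (RG E C D) (F, \<phi>) Y Z \<beta> \<alpha>) w = fst \<beta> (fst \<alpha> w)"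
  by (simp add: RG_def graph_map_comp_def compose_def)

lemma RG_hom_verts:
  assumes "\<alpha> \<in> Hom (RG E C D) (F, \<phi>) (G, \<psi>)" "w \<in> verts F"
  shows "fst \<alpha> w \<in> verts G"
  using assms by (auto simp: RG_def graph_hom_def)

lemma is_category_RG:
  "is_category (RG E C D :: (('v, 'e, 'q, 'f) rep_graph, ('q, 'f, 'q, 'f) graph_map) cat)"
    (is "is_category ?RG")
proof -
  have Ob: "X \<in> Ob ?RG \<longleftrightarrow> representation_graph E C D X" for X by (simp add: RG_def)
  have unit: "Comp ?RG (F, \<phi>) (F, \<phi>) (G, \<psi>) \<alpha> (Idn ?RG (F, \<phi>)) = \<alpha>" (is "?r = \<alpha>")
    "Comp ?RG (F, \<phi>) (G, \<psi>) (G, \<psi>) (Idn ?RG (G, \<psi>)) \<alpha> = \<alpha>" (is "?l = \<alpha>")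
    if F: "representation_graph E C D (F, \<phi>)" and G: "representation_graph E C D (G, \<psi>)"
      and \<alpha>: "\<alpha> \<in> Hom ?RG (F, \<phi>) (G, \<psi>)" for F \<phi> G \<psi> \<alpha>
  proof -
    show "?r = \<alpha>"
      by (rule RG_hom_eqI[OF F G RG_Comp[OF F F RG_Idn[OF F] \<alpha>] \<alpha>])
        (simp add: fst_RG_Idn fst_RG_Comp)
    show "?l = \<alpha>"
      by (rule RG_hom_eqI[OF F G RG_Comp[OF F G \<alpha> RG_Idn[OF G]] \<alpha>])
        (simp add: fst_RG_Idn fst_RG_Comp RG_hom_verts[OF \<alpha>])
  qed
  have assoc: "Comp ?RG (F, \<phi>) (H, \<chi>) (K, \<kappa>) \<gamma> (Comp ?RG (F, \<phi>) (G, \<psi>) (H, \<chi>) \<beta> \<alpha>) =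
      Comp ?RG (F, \<phi>) (G, \<psi>) (K, \<kappa>) (Comp ?RG (G, \<psi>) (H, \<chi>) (K, \<kappa>) \<gamma> \<beta>) \<alpha>"
    if F: "representation_graph E C D (F, \<phi>)" and G: "representation_graph E C D (G, \<psi>)"
      and H: "representation_graph E C D (H, \<chi>)" and K: "representation_graph E C D (K, \<kappa>)"
      and \<alpha>: "\<alpha> \<in> Hom ?RG (F, \<phi>) (G, \<psi>)" and \<beta>: "\<beta> \<in> Hom ?RG (G, \<psi>) (H, \<chi>)"
      and \<gamma>: "\<gamma> \<in> Hom ?RG (H, \<chi>) (K, \<kappa>)" for F \<phi> G \<psi> H \<chi> K \<kappa> \<alpha> \<beta> \<gamma>
    by (rule RG_hom_eqI[OF F K RG_Comp[OF F H RG_Comp[OF F G \<alpha> \<beta>] \<gamma>]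
          RG_Comp[OF F G \<alpha> RG_Comp[OF G H \<beta> \<gamma>]]])
      (simp add: fst_RG_Comp RG_hom_verts[OF \<alpha>])
  show ?thesis
    unfolding is_category_def Ball_def Ob split_paired_All
    by (intro conjI allI impI; (rule RG_Idn RG_Comp unit assoc; assumption))
qed


section \<open>The category of algebraic branching systems\<close>

context
  fixes S :: "('v, 'e, 'q) branching_system"
  assumes abs: "algebraic_branching_system E C D S"
begin

lemma abs_Qs_C: "v \<in> verts E \<Longrightarrow> X \<in> C v \<Longrightarrow> Qs S v = (\<Union>e\<in>X. Ss S e)"
  and abs_Qs_D: "v \<in> verts E \<Longrightarrow> Y \<in> D v \<Longrightarrow> Qs S v = (\<Union>e\<in>Y. Rs S e)"
  and abs_Qs_disjoint: "disjoint_family_on (Qs S) (verts E)"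
  and abs_Ss_disjoint: "v \<in> verts E \<Longrightarrow> X \<in> C v \<Longrightarrow> disjoint_family_on (Ss S) X"
  and abs_Rs_disjoint: "v \<in> verts E \<Longrightarrow> Y \<in> D v \<Longrightarrow> disjoint_family_on (Rs S) Y"
  and abs_space: "space S = (\<Union>v\<in>verts E. Qs S v)"
  and abs_bij: "e \<in> arcs E \<Longrightarrow> bij_betw (rho S e) (Ss S e) (Rs S e)"
  using abs unfolding algebraic_branching_system_def by meson+

lemma abs_nonempty: "space S \<noteq> {}"
  using abs unfolding algebraic_branching_system_def by meson

lemma abs_extensional:
  "Qs S \<in> extensional (verts E)" "Ss S \<in> extensional (arcs E)"
  "Rs S \<in> extensional (arcs E)" "rho S \<in> extensional (arcs E)"
  "e \<in> arcs E \<Longrightarrow> rho S e \<in> extensional (Ss S e)"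
  using abs unfolding algebraic_branching_system_def by meson+

lemma abs_Qs_unique:
  "\<lbrakk>v \<in> verts E; v' \<in> verts E; q \<in> Qs S v; q \<in> Qs S v'\<rbrakk> \<Longrightarrow> v = v'"
  using abs_Qs_disjoint unfolding disjoint_family_on_def by blast

lemma abs_Ss_unique:
  "\<lbrakk>v \<in> verts E; X \<in> C v; e \<in> X; e' \<in> X; q \<in> Ss S e; q \<in> Ss S e'\<rbrakk> \<Longrightarrow> e = e'"
  using abs_Ss_disjoint[of v X] unfolding disjoint_family_on_def by blast

lemma abs_Rs_unique:
  "\<lbrakk>v \<in> verts E; Y \<in> D v; e \<in> Y; e' \<in> Y; q \<in> Rs S e; q \<in> Rs S e'\<rbrakk> \<Longrightarrow> e = e'"
  using abs_Rs_disjoint[of v Y] unfolding disjoint_family_on_def by blast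

lemma abs_Ss_Qs:
  assumes "e \<in> arcs E" "q \<in> Ss S e"
  shows "q \<in> Qs S (tail E e)"
proof -
  obtain X where "X \<in> C (tail E e)" "e \<in> X" using C_cell_ex[OF assms(1)] .
  then show ?thesis using abs_Qs_C[OF tail_in_verts_E[OF assms(1)]] assms(2) by auto
qed

lemma abs_Rs_Qs:
  assumes "e \<in> arcs E" "q \<in> Rs S e"
  shows "q \<in> Qs S (head E e)"
proof -
  obtain Y where "Y \<in> D (head E e)" "e \<in> Y" using D_cell_ex[OF assms(1)] .
  then show ?thesis using abs_Qs_D[OF head_in_verts_E[OF assms(1)]] assms(2) by auto
qed

lemma abs_in_space:
  "v \<in> verts E \<Longrightarrow> q \<in> Qs S v \<Longrightarrow> q \<in> space S"
  "e \<in> arcs E \<Longrightarrow> q \<in> Ss S e \<Longrightarrow> q \<in> space S"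
  "e \<in> arcs E \<Longrightarrow> q \<in> Rs S e \<Longrightarrow> q \<in> space S"
  unfolding abs_space
  by (rule UN_I; assumption)
    (rule UN_I[OF tail_in_verts_E] UN_I[OF head_in_verts_E]; (assumption | rule abs_Ss_Qs abs_Rs_Qs); assumption)+

lemma abs_rho: "e \<in> arcs E \<Longrightarrow> q \<in> Ss S e \<Longrightarrow> rho S e q \<in> Rs S e"
  using abs_bij bij_betwE by blast

lemma eta_label_eq:
  assumes "v \<in> verts E" "X \<in> C v" "e \<in> X" "q \<in> Ss S e"
  shows "eta_label S q X = e"
  unfolding eta_label_def using assms abs_Ss_unique by blast

lemma eta_label:
  assumes "v \<in> verts E" "q \<in> Qs S v" "X \<in> C v"
  shows "eta_label S q X \<in> X" "q \<in> Ss S (eta_label S q X)"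
proof -
  obtain e where "e \<in> X" "q \<in> Ss S e" using abs_Qs_C assms by auto
  then show "eta_label S q X \<in> X" "q \<in> Ss S (eta_label S q X)"
    using eta_label_eq[OF assms(1,3)] by auto
qed

lemma the_Qs: "v \<in> verts E \<Longrightarrow> q \<in> Qs S v \<Longrightarrow> (THE v. v \<in> verts E \<and> q \<in> Qs S v) = v"
  using abs_Qs_unique by blast

end

lemma ABS_hom:
  assumes "\<alpha> \<in> Hom (ABS E C D) S T"
  shows "\<alpha> \<in> space S \<rightarrow>\<^sub>E space T"
    "v \<in> verts E \<Longrightarrow> q \<in> Qs S v \<Longrightarrow> \<alpha> q \<in> Qs T v"
    "e \<in> arcs E \<Longrightarrow> q \<in> Ss S e \<Longrightarrow> \<alpha> q \<in> Ss T e"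
    "e \<in> arcs E \<Longrightarrow> q \<in> Rs S e \<Longrightarrow> \<alpha> q \<in> Rs T e"
    "e \<in> arcs E \<Longrightarrow> q \<in> Ss S e \<Longrightarrow> \<alpha> (rho S e q) = rho T e (\<alpha> q)"
  using assms by (auto simp: ABS_def image_subset_iff)

lemma ABS_homI:
  assumes "\<alpha> \<in> space S \<rightarrow>\<^sub>E space T"
    "\<And>v q. v \<in> verts E \<Longrightarrow> q \<in> Qs S v \<Longrightarrow> \<alpha> q \<in> Qs T v"
    "\<And>e q. e \<in> arcs E \<Longrightarrow> q \<in> Ss S e \<Longrightarrow> \<alpha> q \<in> Ss T e"
    "\<And>e q. e \<in> arcs E \<Longrightarrow> q \<in> Rs S e \<Longrightarrow> \<alpha> q \<in> Rs T e"
    "\<And>e q. e \<in> arcs E \<Longrightarrow> q \<in> Ss S e \<Longrightarrow> \<alpha> (rho S e q) = rho T e (\<alpha> q)"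
  shows "\<alpha> \<in> Hom (ABS E C D) S T"
  unfolding ABS_def using assms by (simp add: image_subset_iff)

lemma ABS_Idn:
  assumes S: "algebraic_branching_system E C D S"
  shows "Idn (ABS E C D) S \<in> Hom (ABS E C D) S S"
  by (rule ABS_homI)
    (auto simp: ABS_def abs_in_space[OF S] abs_in_space(3)[OF S _ abs_rho[OF S]])

lemma ABS_Comp:
  assumes S: "algebraic_branching_system E C D S"
    and \<alpha>: "\<alpha> \<in> Hom (ABS E C D) S T" and \<beta>: "\<beta> \<in> Hom (ABS E C D) T U"
  shows "Comp (ABS E C D) S Y Z \<beta> \<alpha> \<in> Hom (ABS E C D) S U"
proof -
  have Comp: "Comp (ABS E C D) S Y Z \<beta> \<alpha> = (\<lambda>q\<in>space S. \<beta> (\<alpha> q))"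
    by (simp add: ABS_def compose_def)
  show ?thesis unfolding Comp
    using ABS_hom(1)[OF \<alpha>] ABS_hom(1)[OF \<beta>]
    by (intro ABS_homI)
      (auto simp: abs_in_space[OF S] abs_in_space(3)[OF S _ abs_rho[OF S]]
        ABS_hom(2-)[OF \<alpha>] ABS_hom(2-)[OF \<beta>])
qed

lemma is_category_ABS:
  "is_category (ABS E C D :: (('v, 'e, 'q) branching_system, 'q \<Rightarrow> 'q) cat)" (is "is_category ?ABS")
proof -
  have Ob: "X \<in> Ob ?ABS \<longleftrightarrow> algebraic_branching_system E C D X" for X by (simp add: ABS_def)
  have Comp: "Comp ?ABS X Y Z g f = compose (space X) g f" for X Y Z g f by (simp add: ABS_def)
  have Idn: "Idn ?ABS X = (\<lambda>q\<in>space X. q)" for X by (simp add: ABS_def)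
  have unit: "compose (space X) \<alpha> (\<lambda>q\<in>space X. q) = \<alpha>" "compose (space X) (\<lambda>q\<in>space Y. q) \<alpha> = \<alpha>"
    if "\<alpha> \<in> Hom ?ABS X Y" for X Y \<alpha>
    using ABS_hom(1)[OF that] by (auto simp: compose_def fun_eq_iff PiE_def extensional_def Pi_def)
  have assoc: "compose (space W) h (compose (space W) g f) = compose (space W) (compose (space X) h g) f"
    if "f \<in> Hom ?ABS W X" for W X f g h
    using ABS_hom(1)[OF that] by (auto simp: compose_def fun_eq_iff PiE_def Pi_def)
  show ?thesis
    unfolding is_category_def Ob Ball_def
    by (intro conjI allI impI; (rule ABS_Idn ABS_Comp; assumption)?)
      (auto simp only: Comp Idn unit intro: assoc)
qed


section \<open>The functor \<open>\<theta>\<close> is fully faithful\<close>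

lemma theta_ob_sel:
  "space (theta_ob E (F, \<phi>)) = verts F"
  "v \<in> verts E \<Longrightarrow> w \<in> Qs (theta_ob E (F, \<phi>)) v \<longleftrightarrow> w \<in> verts F \<and> fst \<phi> w = v"
  by (auto simp: theta_ob_def Let_def)

context
  fixes F :: "('q, 'f) pre_digraph" and \<phi> :: "('q, 'f, 'v, 'e) graph_map"
  assumes rep: "representation_graph E C D (F, \<phi>)"
begin

lemma theta_Ss_iff:
  "e \<in> arcs E \<Longrightarrow> w \<in> Ss (theta_ob E (F, \<phi>)) e \<longleftrightarrow> (\<exists>g\<in>arcs F. tail F g = w \<and> snd \<phi> g = e)"
  and theta_Rs_iff:
  "e \<in> arcs E \<Longrightarrow> w \<in> Rs (theta_ob E (F, \<phi>)) e \<longleftrightarrow> (\<exists>g\<in>arcs F. head F g = w \<and> snd \<phi> g = e)"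
  using rep_verts[OF rep] by (auto simp: theta_ob_def Let_def)

lemma theta_rho:
  assumes g: "g \<in> arcs F"
  shows "rho (theta_ob E (F, \<phi>)) (snd \<phi> g) (tail F g) = head F g"
proof -
  have "(THE h. h \<in> out_arcs F (tail F g) \<and> snd \<phi> h = snd \<phi> g) = g"
    by (rule the_equality) (use g in \<open>auto intro: rep_out_unique[OF rep]\<close>)
  moreover have "\<exists>h\<in>out_arcs F (tail F g). snd \<phi> h = snd \<phi> g" using g by auto
  ultimately show ?thesis
    using g rep_map(2)[OF rep g] rep_verts(2)[OF rep g] by (simp add: theta_ob_def Let_def)
qed

text \<open>Existence in conditions (i) and (ii) says that the \<open>S\<^sub>e\<close>, respectively the \<open>R\<^sub>e\<close>, over a cell
  cover \<open>Q\<^sub>v\<close>, uniqueness that they are disjoint. Uniqueness in (ii) also makes \<open>\<rho>\<^sub>e\<close> injective.\<close>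

lemma theta_ob_abs: "algebraic_branching_system E C D (theta_ob E (F, \<phi>))"
proof -
  let ?S = "theta_ob E (F, \<phi>)"
  have ext: "Qs ?S \<in> extensional (verts E)" "Ss ?S \<in> extensional (arcs E)"
    "Rs ?S \<in> extensional (arcs E)" "rho ?S \<in> extensional (arcs E)"
    and ext': "\<forall>e\<in>arcs E. rho ?S e \<in> extensional (Ss ?S e)"
    by (auto simp: theta_ob_def Let_def)
  have disj: "disjoint_family_on (Qs ?S) (verts E)"
    by (auto simp: disjoint_family_on_def theta_ob_sel)
  have space: "space ?S = (\<Union>v\<in>verts E. Qs ?S v)"
    using rep_map(1)[OF rep] by (auto simp: theta_ob_sel)
  have C: "Qs ?S v = (\<Union>e\<in>X. Ss ?S e) \<and> disjoint_family_on (Ss ?S) X"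
    if v: "v \<in> verts E" and X: "X \<in> C v" for v X
  proof
    note cell = C_cell[OF v X]
    show "Qs ?S v = (\<Union>e\<in>X. Ss ?S e)"
    proof (rule set_eqI)
      fix w
      have "w \<in> verts F \<and> fst \<phi> w = v \<longleftrightarrow> (\<exists>g\<in>arcs F. tail F g = w \<and> snd \<phi> g \<in> X)"
      proof
        assume "w \<in> verts F \<and> fst \<phi> w = v"
        then show "\<exists>g\<in>arcs F. tail F g = w \<and> snd \<phi> g \<in> X"
          using rep_out_ex[OF rep, of w X] X by blast
      next
        assume "\<exists>g\<in>arcs F. tail F g = w \<and> snd \<phi> g \<in> X"
        then obtain g where "g \<in> arcs F" "tail F g = w" "snd \<phi> g \<in> X" by blast
        then show "w \<in> verts F \<and> fst \<phi> w = v"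
          using cell(2)[of "snd \<phi> g"] rep_map(3)[OF rep, of g] rep_verts(2)[OF rep, of g] by simp
      qed
      also have "\<dots> \<longleftrightarrow> w \<in> (\<Union>e\<in>X. Ss ?S e)"
        using cell by (auto simp: theta_Ss_iff)
      finally show "w \<in> Qs ?S v \<longleftrightarrow> w \<in> (\<Union>e\<in>X. Ss ?S e)"
        by (simp add: theta_ob_sel v)
    qed
    show "disjoint_family_on (Ss ?S) X"
      unfolding disjoint_family_on_def
    proof (intro ballI impI, rule ccontr)
      fix e e' assume e: "e \<in> X" "e' \<in> X" "e \<noteq> e'" "Ss ?S e \<inter> Ss ?S e' \<noteq> {}"
      then obtain w where w: "w \<in> Ss ?S e" "w \<in> Ss ?S e'" by auto
      obtain g where g: "g \<in> arcs F" "tail F g = w" "snd \<phi> g = e"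
        using w(1) unfolding theta_Ss_iff[OF cell(1)[OF e(1)]] by auto
      obtain g' where g': "g' \<in> arcs F" "tail F g' = w" "snd \<phi> g' = e'"
        using w(2) unfolding theta_Ss_iff[OF cell(1)[OF e(2)]] by auto
      have "fst \<phi> (tail F g) = v"
        using rep_map(3)[OF rep g(1)] cell(2)[OF e(1)] g(3) by simp
      then have "g = g'"
        by (intro rep_out_unique_cell[OF rep g(1) g'(1), of X])
          (simp_all only: g(2,3) g'(2,3) X e(1,2))
      then show False using e(3) g(3) g'(3) by simp
    qed
  qed
  have D: "Qs ?S v = (\<Union>e\<in>Y. Rs ?S e) \<and> disjoint_family_on (Rs ?S) Y"
    if v: "v \<in> verts E" and Y: "Y \<in> D v" for v Y
  proof
    note cell = D_cell[OF v Y]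
    show "Qs ?S v = (\<Union>e\<in>Y. Rs ?S e)"
    proof (rule set_eqI)
      fix w
      have "w \<in> verts F \<and> fst \<phi> w = v \<longleftrightarrow> (\<exists>g\<in>arcs F. head F g = w \<and> snd \<phi> g \<in> Y)"
      proof
        assume "w \<in> verts F \<and> fst \<phi> w = v"
        then show "\<exists>g\<in>arcs F. head F g = w \<and> snd \<phi> g \<in> Y"
          using rep_in_ex[OF rep, of w Y] Y by blast
      next
        assume "\<exists>g\<in>arcs F. head F g = w \<and> snd \<phi> g \<in> Y"
        then obtain g where "g \<in> arcs F" "head F g = w" "snd \<phi> g \<in> Y" by blast
        then show "w \<in> verts F \<and> fst \<phi> w = v"
          using cell(2)[of "snd \<phi> g"] rep_map(4)[OF rep, of g] rep_verts(3)[OF rep, of g] by simp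
      qed
      also have "\<dots> \<longleftrightarrow> w \<in> (\<Union>e\<in>Y. Rs ?S e)"
        using cell by (auto simp: theta_Rs_iff)
      finally show "w \<in> Qs ?S v \<longleftrightarrow> w \<in> (\<Union>e\<in>Y. Rs ?S e)"
        by (simp add: theta_ob_sel v)
    qed
    show "disjoint_family_on (Rs ?S) Y"
      unfolding disjoint_family_on_def
    proof (intro ballI impI, rule ccontr)
      fix e e' assume e: "e \<in> Y" "e' \<in> Y" "e \<noteq> e'" "Rs ?S e \<inter> Rs ?S e' \<noteq> {}"
      then obtain w where w: "w \<in> Rs ?S e" "w \<in> Rs ?S e'" by auto
      obtain g where g: "g \<in> arcs F" "head F g = w" "snd \<phi> g = e"
        using w(1) unfolding theta_Rs_iff[OF cell(1)[OF e(1)]] by auto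
      obtain g' where g': "g' \<in> arcs F" "head F g' = w" "snd \<phi> g' = e'"
        using w(2) unfolding theta_Rs_iff[OF cell(1)[OF e(2)]] by auto
      have "fst \<phi> (head F g) = v"
        using rep_map(4)[OF rep g(1)] cell(2)[OF e(1)] g(3) by simp
      then have "g = g'"
        by (intro rep_in_unique_cell[OF rep g(1) g'(1), of Y])
          (simp_all only: g(2,3) g'(2,3) Y e(1,2))
      then show False using e(3) g(3) g'(3) by simp
    qed
  qed
  have bij: "bij_betw (rho ?S e) (Ss ?S e) (Rs ?S e)" if e: "e \<in> arcs E" for e
    unfolding bij_betw_def
  proof
    show "inj_on (rho ?S e) (Ss ?S e)"
    proof (rule inj_onI)
      fix w w' assume "w \<in> Ss ?S e" "w' \<in> Ss ?S e" and eq: "rho ?S e w = rho ?S e w'"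
      then obtain g h where g: "g \<in> arcs F" "tail F g = w" "snd \<phi> g = e"
        and h: "h \<in> arcs F" "tail F h = w'" "snd \<phi> h = e"
        unfolding theta_Ss_iff[OF e] by auto
      have "head F g = head F h"
        using eq theta_rho[OF g(1)] theta_rho[OF h(1)] g h by simp
      then show "w = w'" using rep_in_unique[OF rep g(1) h(1)] g h by simp
    qed
    show "rho ?S e ` Ss ?S e = Rs ?S e"
    proof (intro equalityI subsetI)
      fix w assume "w \<in> rho ?S e ` Ss ?S e"
      then obtain g where "g \<in> arcs F" "snd \<phi> g = e" "w = rho ?S e (tail F g)"
        by (auto simp: theta_Ss_iff[OF e])
      then show "w \<in> Rs ?S e"
        unfolding theta_Rs_iff[OF e] using theta_rho[of g] by (intro bexI[of _ g]) auto
    next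
      fix w assume "w \<in> Rs ?S e"
      then obtain g where g: "g \<in> arcs F" "head F g = w" "snd \<phi> g = e"
        by (auto simp: theta_Rs_iff[OF e])
      then have "tail F g \<in> Ss ?S e" unfolding theta_Ss_iff[OF e] by auto
      moreover have "w = rho ?S e (tail F g)" using theta_rho[OF g(1)] g by simp
      ultimately show "w \<in> rho ?S e ` Ss ?S e" by (rule rev_image_eqI)
    qed
  qed
  have "space ?S \<noteq> {}" using rep_verts(1)[OF rep] by (simp add: theta_ob_sel)
  then show ?thesis
    unfolding algebraic_branching_system_def
    using ext ext' disj space C D bij by (intro conjI ballI) simp_all
qed

end

lemma FMor_theta: "FMor (theta E) (F, \<phi>) (G, \<psi>) \<alpha> = restrict (fst \<alpha>) (verts F)"
  and FOb_theta: "FOb (theta E) = theta_ob E"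
  by (simp_all add: theta_def)

lemma theta_hom:
  assumes F: "representation_graph E C D (F, \<phi>)" and G: "representation_graph E C D (G, \<psi>)"
    and \<alpha>: "\<alpha> \<in> Hom (RG E C D) (F, \<phi>) (G, \<psi>)"
  shows "restrict (fst \<alpha>) (verts F) \<in> Hom (ABS E C D) (theta_ob E (F, \<phi>)) (theta_ob E (G, \<psi>))"
proof (rule ABS_homI)
  note a = \<alpha>[unfolded RG_hom_iff[OF F] graph_hom_def]
  show "restrict (fst \<alpha>) (verts F) \<in> space (theta_ob E (F, \<phi>)) \<rightarrow>\<^sub>E space (theta_ob E (G, \<psi>))"
    using a by (auto simp: theta_ob_sel)
  show "restrict (fst \<alpha>) (verts F) q \<in> Qs (theta_ob E (G, \<psi>)) v"
    if "v \<in> verts E" "q \<in> Qs (theta_ob E (F, \<phi>)) v" for v q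
    using a that by (auto simp: theta_ob_sel)
  have arc: "snd \<alpha> g \<in> arcs G" "tail G (snd \<alpha> g) = fst \<alpha> (tail F g)"
    "head G (snd \<alpha> g) = fst \<alpha> (head F g)" "snd \<psi> (snd \<alpha> g) = snd \<phi> g" if "g \<in> arcs F" for g
    using a that by auto
  note [simp] = rep_verts(2,3)[OF F]
  show "restrict (fst \<alpha>) (verts F) q \<in> Ss (theta_ob E (G, \<psi>)) e"
    if e: "e \<in> arcs E" and q: "q \<in> Ss (theta_ob E (F, \<phi>)) e" for e q
  proof -
    obtain g where "g \<in> arcs F" "tail F g = q" "snd \<phi> g = e"
      using q unfolding theta_Ss_iff[OF F e] by auto
    then show ?thesis
      unfolding theta_Ss_iff[OF G e] using arc[of g] by (intro bexI[of _ "snd \<alpha> g"]) auto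
  qed
  show "restrict (fst \<alpha>) (verts F) q \<in> Rs (theta_ob E (G, \<psi>)) e"
    if e: "e \<in> arcs E" and q: "q \<in> Rs (theta_ob E (F, \<phi>)) e" for e q
  proof -
    obtain g where "g \<in> arcs F" "head F g = q" "snd \<phi> g = e"
      using q unfolding theta_Rs_iff[OF F e] by auto
    then show ?thesis
      unfolding theta_Rs_iff[OF G e] using arc[of g] by (intro bexI[of _ "snd \<alpha> g"]) auto
  qed
  show "restrict (fst \<alpha>) (verts F) (rho (theta_ob E (F, \<phi>)) e q) =
      rho (theta_ob E (G, \<psi>)) e (restrict (fst \<alpha>) (verts F) q)"
    if e: "e \<in> arcs E" and q: "q \<in> Ss (theta_ob E (F, \<phi>)) e" for e q
  proof -
    obtain g where g: "g \<in> arcs F" "tail F g = q" "snd \<phi> g = e"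
      using q unfolding theta_Ss_iff[OF F e] by auto
    then show ?thesis
      using theta_rho[OF F g(1)] theta_rho[OF G arc(1)[OF g(1)]] arc[OF g(1)] by auto
  qed
qed

lemma is_functor_theta:
  "is_functor (RG E C D :: (('v, 'e, 'q, 'f) rep_graph, ('q, 'f, 'q, 'f) graph_map) cat)
     (ABS E C D) (theta E)" (is "is_functor ?RG ?ABS ?\<theta>")
proof -
  have Ob: "X \<in> Ob ?RG \<longleftrightarrow> representation_graph E C D X" for X by (simp add: RG_def)
  have Ob': "X \<in> Ob ?ABS \<longleftrightarrow> algebraic_branching_system E C D X" for X by (simp add: ABS_def)
  have comp: "FMor ?\<theta> (F, \<phi>) Z (Comp ?RG (F, \<phi>) (G, \<psi>) Z \<beta> \<alpha>) =
      Comp ?ABS (theta_ob E (F, \<phi>)) Y' Z' (FMor ?\<theta> (G, \<psi>) Z \<beta>) (FMor ?\<theta> (F, \<phi>) (G, \<psi>) \<alpha>)"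
    if "\<alpha> \<in> Hom ?RG (F, \<phi>) (G, \<psi>)" for F \<phi> G \<psi> Z Y' Z' \<alpha> \<beta>
    using RG_hom_verts[OF that]
    by (cases Z) (auto simp: FMor_theta ABS_def theta_ob_sel fun_eq_iff compose_def fst_RG_Comp)
  have mor: "FMor ?\<theta> (F, \<phi>) (G, \<psi>) \<alpha> \<in> Hom ?ABS (theta_ob E (F, \<phi>)) (theta_ob E (G, \<psi>))"
    if "representation_graph E C D (F, \<phi>)" "representation_graph E C D (G, \<psi>)"
      "\<alpha> \<in> Hom ?RG (F, \<phi>) (G, \<psi>)" for F \<phi> G \<psi> \<alpha>
    unfolding FMor_theta by (rule theta_hom[OF that])
  have idn: "FMor ?\<theta> (F, \<phi>) (F, \<phi>) (Idn ?RG (F, \<phi>)) = Idn ?ABS (theta_ob E (F, \<phi>))" for F \<phi>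
    by (auto simp: FMor_theta fst_RG_Idn ABS_def theta_ob_sel fun_eq_iff)
  show ?thesis
    unfolding is_functor_def Ball_def Ob Ob' split_paired_All FOb_theta
    by (intro conjI allI impI; (rule idn | (rule theta_ob_abs mor comp; assumption)))
qed

text \<open>\<open>\<theta>\<close> is full: an arc \<open>g\<close> with label \<open>e\<close> witnesses that its tail lies in \<open>S\<^sub>e\<close>, so \<open>\<beta>\<close> maps
  this tail into the corresponding set of the other system, whose membership is again witnessed by
  an arc with label \<open>e\<close>. That arc is the image of \<open>g\<close>, and compatibility of \<open>\<beta>\<close> with the bijections
  \<open>\<rho>\<^sub>e\<close> says that its head is the right one.\<close>

lemma theta_full:
  assumes F: "representation_graph E C D (F, \<phi>)" and G: "representation_graph E C D (G, \<psi>)"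
    and \<beta>: "\<beta> \<in> Hom (ABS E C D) (theta_ob E (F, \<phi>)) (theta_ob E (G, \<psi>))"
  obtains \<alpha> where "\<alpha> \<in> Hom (RG E C D) (F, \<phi>) (G, \<psi>)" "fst \<alpha> = \<beta>"
proof -
  have "\<exists>h\<in>arcs G. tail G h = \<beta> (tail F g) \<and> head G h = \<beta> (head F g) \<and> snd \<psi> h = snd \<phi> g"
    if g: "g \<in> arcs F" for g
  proof -
    note e = rep_map(2)[OF F g]
    have S: "tail F g \<in> Ss (theta_ob E (F, \<phi>)) (snd \<phi> g)"
      using g unfolding theta_Ss_iff[OF F e] by auto
    obtain h where h: "h \<in> arcs G" "tail G h = \<beta> (tail F g)" "snd \<psi> h = snd \<phi> g"
      using ABS_hom(3)[OF \<beta> e S] unfolding theta_Ss_iff[OF G e] by auto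
    then show ?thesis
      using ABS_hom(5)[OF \<beta> e S] theta_rho[OF F g] theta_rho[OF G h(1)] by auto
  qed
  then obtain b where b: "\<And>g. g \<in> arcs F \<Longrightarrow> b g \<in> arcs G \<and> tail G (b g) = \<beta> (tail F g) \<and>
      head G (b g) = \<beta> (head F g) \<and> snd \<psi> (b g) = snd \<phi> g"
    by metis
  have "fst \<psi> (\<beta> w) = fst \<phi> w" if "w \<in> verts F" for w
    using ABS_hom(2)[OF \<beta>, of "fst \<phi> w" w] rep_map(1)[OF F that] that by (simp add: theta_ob_sel)
  then have "(\<beta>, restrict b (arcs F)) \<in> Hom (RG E C D) (F, \<phi>) (G, \<psi>)"
    unfolding RG_hom_iff[OF F] graph_hom_def
    using b ABS_hom(1)[OF \<beta>] by (auto simp: theta_ob_sel)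
  then show ?thesis using that by simp
qed

text \<open>A fully faithful functor reflects isomorphisms; here the isomorphism between the images is an
  identity, and \<open>\<alpha>\<close> is its lift.\<close>

lemma iso_if_theta_ob_eq:
  assumes F: "representation_graph E C D (F, \<phi>)" and G: "representation_graph E C D (G, \<psi>)"
    and eq: "theta_ob E (F, \<phi>) = theta_ob E (G, \<psi>)"
  obtains \<alpha> where "is_iso (RG E C D) (F, \<phi>) (G, \<psi>) \<alpha>" "\<And>w. w \<in> verts F \<Longrightarrow> fst \<alpha> w = w"
proof -
  have verts: "verts F = verts G" using arg_cong[OF eq, of space] by (simp add: theta_ob_sel)
  let ?i = "Idn (ABS E C D) (theta_ob E (F, \<phi>))"
  have i: "?i \<in> Hom (ABS E C D) (theta_ob E (F, \<phi>)) (theta_ob E (F, \<phi>))"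
    by (rule ABS_Idn[OF theta_ob_abs[OF F]])
  have i_eq: "?i w = w" if "w \<in> verts F" for w using that by (simp add: ABS_def theta_ob_sel)
  obtain \<alpha> where \<alpha>: "\<alpha> \<in> Hom (RG E C D) (F, \<phi>) (G, \<psi>)" "fst \<alpha> = ?i"
    using theta_full[OF F G] i eq by metis
  obtain \<beta> where \<beta>: "\<beta> \<in> Hom (RG E C D) (G, \<psi>) (F, \<phi>)" "fst \<beta> = ?i"
    using theta_full[OF G F] i eq by metis
  have "Comp (RG E C D) (F, \<phi>) (G, \<psi>) (F, \<phi>) \<beta> \<alpha> = Idn (RG E C D) (F, \<phi>)"
    by (rule RG_hom_eqI[OF F F RG_Comp[OF F G \<alpha>(1) \<beta>(1)] RG_Idn[OF F]])
      (simp add: fst_RG_Comp fst_RG_Idn \<alpha> \<beta> i_eq)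
  moreover have "Comp (RG E C D) (G, \<psi>) (F, \<phi>) (G, \<psi>) \<alpha> \<beta> = Idn (RG E C D) (G, \<psi>)"
    by (rule RG_hom_eqI[OF G G RG_Comp[OF G F \<beta>(1) \<alpha>(1)] RG_Idn[OF G]])
      (simp add: fst_RG_Comp fst_RG_Idn \<alpha> \<beta> i_eq verts)
  ultimately have "is_iso (RG E C D) (F, \<phi>) (G, \<psi>) \<alpha>"
    unfolding is_iso_def using \<alpha>(1) \<beta>(1) by blast
  then show ?thesis by (rule that) (simp add: \<alpha>(2) i_eq)
qed

end


section \<open>The functor \<open>\<eta>\<close>\<close>

locale bi_separated_symbols = bi_separated E C D
  for E :: "('v, 'e) pre_digraph" and C D :: "'v \<Rightarrow> 'e set set" +
  fixes f :: "'q \<Rightarrow> 'e set \<Rightarrow> 'f"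
  assumes edge_symbols: "edge_symbols E C f"
begin

lemma eta_decode:
  assumes "v \<in> verts E" "q \<in> Qs S v" "X \<in> C v"
  shows "eta_decode E C f S (f q X) = (q, X)"
proof -
  have "inj_on (\<lambda>(q, X). f q X) (eta_index E C S)"
    by (rule inj_on_subset[OF edge_symbols[unfolded edge_symbols_def]])
      (auto simp: eta_index_def)
  moreover have "(q, X) \<in> eta_index E C S" using assms by (auto simp: eta_index_def)
  ultimately have "inv_into (eta_index E C S) (\<lambda>(q, X). f q X) ((\<lambda>(q, X). f q X) (q, X)) = (q, X)"
    by (rule inv_into_f_f)
  then show ?thesis by (simp add: eta_decode_def)
qed

lemma eta_arcsI: "\<lbrakk>v \<in> verts E; q \<in> Qs S v; X \<in> C v\<rbrakk> \<Longrightarrow> f q X \<in> eta_arcs E C f S"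
  by (force simp: eta_arcs_def eta_index_def)

lemma eta_arcsE:
  assumes "a \<in> eta_arcs E C f S"
  obtains v q X where "v \<in> verts E" "q \<in> Qs S v" "X \<in> C v" "a = f q X"
  using assms by (auto simp: eta_arcs_def eta_index_def)

definition eta_graph :: "('v, 'e, 'q) branching_system \<Rightarrow> ('q, 'f) pre_digraph" where
  "eta_graph S = fst (eta_ob E C f S)"

definition eta_map :: "('v, 'e, 'q) branching_system \<Rightarrow> ('q, 'f, 'v, 'e) graph_map" where
  "eta_map S = snd (eta_ob E C f S)"

lemma eta_ob_eq: "eta_ob E C f S = (eta_graph S, eta_map S)"
  by (simp add: eta_graph_def eta_map_def)

lemma eta_graph_sel:
  "verts (eta_graph S) = space S" "arcs (eta_graph S) = eta_arcs E C f S"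
  by (simp_all add: eta_graph_def eta_ob_def)

lemma eta_arc:
  assumes "v \<in> verts E" "q \<in> Qs S v" "X \<in> C v"
  shows "tail (eta_graph S) (f q X) = q"
    "head (eta_graph S) (f q X) = rho S (eta_label S q X) q"
    "snd (eta_map S) (f q X) = eta_label S q X"
  using eta_arcsI[of v q S X] eta_decode[of v q S X] assms
  by (simp_all add: eta_graph_def eta_map_def eta_ob_def)

lemma eta_vert:
  assumes "algebraic_branching_system E C D S" "v \<in> verts E" "q \<in> Qs S v"
  shows "fst (eta_map S) q = v"
  using the_Qs[OF assms] abs_in_space(1)[OF assms] by (simp add: eta_map_def eta_ob_def)

lemma eta_ob_extensional:
  "fst (eta_map S) \<in> extensional (space S)" "snd (eta_map S) \<in> extensional (eta_arcs E C f S)"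
  "tail (eta_graph S) \<in> extensional (eta_arcs E C f S)"
  "head (eta_graph S) \<in> extensional (eta_arcs E C f S)"
  by (simp_all add: eta_map_def eta_graph_def eta_ob_def)

context
  fixes S :: "('v, 'e, 'q) branching_system"
  assumes abs: "algebraic_branching_system E C D S"
begin

lemma eta_label_arc:
  assumes "v \<in> verts E" "q \<in> Qs S v" "X \<in> C v"
  shows "eta_label S q X \<in> arcs E" "tail E (eta_label S q X) = v"
    "rho S (eta_label S q X) q \<in> Rs S (eta_label S q X)"
proof -
  note l = eta_label[OF abs assms]
  show e: "eta_label S q X \<in> arcs E" "tail E (eta_label S q X) = v"
    using C_cell[OF assms(1,3) l(1)] by auto
  show "rho S (eta_label S q X) q \<in> Rs S (eta_label S q X)" by (rule abs_rho[OF abs e(1) l(2)])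
qed

text \<open>The arc is \<open>f\<^bsub>q,X\<^esub>\<close> for the cell \<open>X\<close> of \<open>C\<close> that contains \<open>e\<close>. Together with the converse
  \<open>eta_arc_mem\<close> this says that the arcs of \<open>\<eta>(S)\<close> with label \<open>e\<close> run from \<open>q\<close> to \<open>\<rho>\<^sub>e(q)\<close> for the
  \<open>q \<in> S\<^sub>e\<close>.\<close>

lemma eta_arc_ex:
  assumes e: "e \<in> arcs E" and q: "q \<in> Ss S e"
  obtains a where "a \<in> arcs (eta_graph S)" "tail (eta_graph S) a = q"
    "head (eta_graph S) a = rho S e q" "snd (eta_map S) a = e"
proof -
  obtain X where X: "X \<in> C (tail E e)" "e \<in> X" using C_cell_ex[OF e] .
  note v = tail_in_verts_E[OF e]
  have Q: "q \<in> Qs S (tail E e)" using abs_Ss_Qs[OF abs e q] .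
  have "eta_label S q X = e" using eta_label_eq[OF abs v X q] .
  then show ?thesis
    using that[of "f q X"] eta_arc[OF v Q X(1)] eta_arcsI[of _ q S X, OF v Q X(1)]
    by (simp add: eta_graph_sel)
qed

lemma eta_arc_mem:
  assumes "a \<in> arcs (eta_graph S)"
  shows "snd (eta_map S) a \<in> arcs E" "tail (eta_graph S) a \<in> Ss S (snd (eta_map S) a)"
    "head (eta_graph S) a = rho S (snd (eta_map S) a) (tail (eta_graph S) a)"
    "head (eta_graph S) a \<in> Rs S (snd (eta_map S) a)"
proof -
  obtain v q X where a: "v \<in> verts E" "q \<in> Qs S v" "X \<in> C v" "a = f q X"
    using assms unfolding eta_graph_sel by (rule eta_arcsE)
  note a' = a(1-3)
  show "snd (eta_map S) a \<in> arcs E" "tail (eta_graph S) a \<in> Ss S (snd (eta_map S) a)"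
    "head (eta_graph S) a = rho S (snd (eta_map S) a) (tail (eta_graph S) a)"
    "head (eta_graph S) a \<in> Rs S (snd (eta_map S) a)"
    unfolding a(4) eta_arc[OF a'] using eta_label_arc[OF a'] eta_label[OF abs a'] by auto
qed

text \<open>The symbol \<open>f\<^bsub>q,X\<^esub>\<close> can be recovered because \<open>X\<close> is the only cell of \<open>C\<close> containing the
  label.\<close>

lemma eta_arc_unique:
  assumes a: "a \<in> arcs (eta_graph S)" and b: "b \<in> arcs (eta_graph S)"
    and t: "tail (eta_graph S) a = tail (eta_graph S) b"
    and l: "snd (eta_map S) a = snd (eta_map S) b"
  shows "a = b"
proof -
  obtain v q X where a: "v \<in> verts E" "q \<in> Qs S v" "X \<in> C v" "a = f q X"
    using a unfolding eta_graph_sel by (rule eta_arcsE)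
  obtain v' q' X' where b: "v' \<in> verts E" "q' \<in> Qs S v'" "X' \<in> C v'" "b = f q' X'"
    using b unfolding eta_graph_sel by (rule eta_arcsE)
  have q: "q' = q" using t by (simp add: a(4) b(4) eta_arc[OF a(1-3)] eta_arc[OF b(1-3)])
  then have v: "v' = v" using abs_Qs_unique[OF abs] a b by blast
  have "eta_label S q X = eta_label S q' X'"
    using l unfolding a(4) b(4) eta_arc[OF a(1-3)] eta_arc[OF b(1-3)] .
  then have "eta_label S q X \<in> X'" using eta_label(1)[OF abs b(1-3)] by simp
  then have "X' = X"
    using C_cell_unique[OF a(1) _ a(3) _ eta_label(1)[OF abs a(1-3)]] b(3) v by simp
  then show ?thesis using a b q by simp
qed

text \<open>The disjoint union of the \<open>S\<^sub>e\<close> over a cell of \<open>C\<close> gives condition (i). For condition (ii), the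
  disjoint union of the \<open>R\<^sub>e\<close> over a cell of \<open>D\<close> gives the label of the incoming arc, and
  bijectivity of \<open>\<rho>\<^sub>e\<close> its tail.\<close>

lemma eta_ob_rep: "representation_graph E C D (eta_graph S, eta_map S)"
proof -
  let ?F = "eta_graph S" and ?\<phi> = "eta_map S"
  have sp: "verts ?F = (\<Union>v\<in>verts E. Qs S v)" by (simp add: eta_graph_sel abs_space[OF abs])
  have sp': "verts ?F = space S" by (simp add: eta_graph_sel)
  have t: "fst ?\<phi> (tail ?F a) = tail E (snd ?\<phi> a)" "tail ?F a \<in> verts ?F"
    and h: "fst ?\<phi> (head ?F a) = head E (snd ?\<phi> a)" "head ?F a \<in> verts ?F"
    if "a \<in> arcs ?F" for a
  proof -
    note m = eta_arc_mem[OF that]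
    show "fst ?\<phi> (tail ?F a) = tail E (snd ?\<phi> a)"
      by (rule eta_vert[OF abs tail_in_verts_E[OF m(1)] abs_Ss_Qs[OF abs m(1,2)]])
    show "fst ?\<phi> (head ?F a) = head E (snd ?\<phi> a)"
      by (rule eta_vert[OF abs head_in_verts_E[OF m(1)] abs_Rs_Qs[OF abs m(1,4)]])
    show "tail ?F a \<in> verts ?F" "head ?F a \<in> verts ?F"
      unfolding sp' using abs_in_space(2)[OF abs m(1,2)] abs_in_space(3)[OF abs m(1,4)] .
  qed
  have wf: "wf_digraph ?F" using t h by (simp add: wf_digraph_def)
  have hom: "graph_hom ?F E ?\<phi>"
    unfolding graph_hom_def
  proof (intro conjI ballI)
    have "fst ?\<phi> w \<in> verts E" if w: "w \<in> verts ?F" for w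
    proof -
      obtain v where v: "v \<in> verts E" "w \<in> Qs S v" using w unfolding sp by blast
      then show ?thesis using eta_vert[OF abs v] by simp
    qed
    then show "fst ?\<phi> \<in> verts ?F \<rightarrow>\<^sub>E verts E"
      using eta_ob_extensional(1)[of S] unfolding PiE_iff sp' by blast
    show "snd ?\<phi> \<in> arcs ?F \<rightarrow>\<^sub>E arcs E"
      using eta_ob_extensional(2)[of S] eta_arc_mem(1) unfolding PiE_iff eta_graph_sel by blast
  qed (use t h in simp_all)
  have out: "\<exists>!a. a \<in> out_arcs ?F w \<and> snd ?\<phi> a \<in> X"
    if w: "w \<in> verts ?F" and X: "X \<in> C (fst ?\<phi> w)" for w X
  proof -
    obtain v where v: "v \<in> verts E" "w \<in> Qs S v" using w by (auto simp: sp)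
    then have X: "X \<in> C v" using X eta_vert[OF abs] by simp
    obtain e where e: "e \<in> X" "w \<in> Ss S e" using abs_Qs_C[OF abs v(1) X] v by auto
    note eE = C_cell[OF v(1) X e(1)]
    obtain a where a: "a \<in> arcs ?F" "tail ?F a = w" "snd ?\<phi> a = e"
      by (rule eta_arc_ex[OF eE(1) e(2)])
    have "b = a" if "b \<in> arcs ?F" "tail ?F b = w" "snd ?\<phi> b \<in> X" for b
    proof (rule eta_arc_unique[OF that(1) a(1)])
      show "tail ?F b = tail ?F a" using that(2) a(2) by simp
      have "w \<in> Ss S (snd ?\<phi> b)" using eta_arc_mem(2)[OF that(1)] that(2) by simp
      then show "snd ?\<phi> b = snd ?\<phi> a"
        using abs_Ss_unique[OF abs v(1) X that(3) e(1) _ e(2)] a(3) by simp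
    qed
    then have "b = a" if "b \<in> out_arcs ?F w \<and> snd ?\<phi> b \<in> X" for b
      using that unfolding out_arcs_def by blast
    moreover have "a \<in> out_arcs ?F w \<and> snd ?\<phi> a \<in> X" using a e(1) by simp
    ultimately show ?thesis by (rule ex1I[rotated])
  qed
  have "in": "\<exists>!a. a \<in> in_arcs ?F w \<and> snd ?\<phi> a \<in> Y"
    if w: "w \<in> verts ?F" and Y: "Y \<in> D (fst ?\<phi> w)" for w Y
  proof -
    obtain v where v: "v \<in> verts E" "w \<in> Qs S v" using w by (auto simp: sp)
    then have Y: "Y \<in> D v" using Y eta_vert[OF abs] by simp
    obtain e where e: "e \<in> Y" "w \<in> Rs S e" using abs_Qs_D[OF abs v(1) Y] v by auto
    note eE = D_cell[OF v(1) Y e(1)]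
    note bij = abs_bij[OF abs eE(1)]
    obtain q where q: "q \<in> Ss S e" "rho S e q = w"
      using e(2)[folded bij_betw_imp_surj_on[OF bij]] by (auto elim: imageE)
    obtain a where a: "a \<in> arcs ?F" "tail ?F a = q" "head ?F a = w" "snd ?\<phi> a = e"
      by (rule eta_arc_ex[OF eE(1) q(1), unfolded q(2)])
    have "b = a" if b: "b \<in> arcs ?F" "head ?F b = w" "snd ?\<phi> b \<in> Y" for b
    proof -
      note m = eta_arc_mem[OF b(1)]
      have l: "snd ?\<phi> b = e"
        using abs_Rs_unique[OF abs v(1) Y b(3) e(1) _ e(2)] m(4) b(2) by simp
      then have "tail ?F b = q"
        using inj_onD[OF bij_betw_imp_inj_on[OF bij], of "tail ?F b" q] m(2,3) b(2) q by simp
      then show ?thesis using eta_arc_unique[OF b(1) a(1)] a l by simp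
    qed
    then have "b = a" if "b \<in> in_arcs ?F w \<and> snd ?\<phi> b \<in> Y" for b
      using that unfolding in_arcs_def by blast
    moreover have "a \<in> in_arcs ?F w \<and> snd ?\<phi> a \<in> Y" using a e(1) by simp
    ultimately show ?thesis by (rule ex1I[rotated])
  qed
  have ne: "verts ?F \<noteq> {}" using abs_nonempty[OF abs] by (simp add: eta_graph_sel)
  show ?thesis
    unfolding representation_graph_def
    using wf hom out "in" ne eta_ob_extensional(3,4)[of S] by (simp add: eta_graph_sel)
qed

lemma theta_eta_ob: "theta_ob E (eta_graph S, eta_map S) = S"
proof -
  let ?T = "theta_ob E (eta_graph S, eta_map S)"
  note rep = eta_ob_rep
  note absT = theta_ob_abs[OF rep]
  note ext = abs_extensional[OF abs] and extT = abs_extensional[OF absT]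
  have Q: "Qs ?T = Qs S"
  proof (rule extensionalityI[of _ "verts E"])
    fix v assume v: "v \<in> verts E"
    show "Qs ?T v = Qs S v"
    proof (intro equalityI subsetI)
      fix w assume "w \<in> Qs ?T v"
      then have w: "w \<in> space S" "fst (eta_map S) w = v"
        unfolding theta_ob_sel(2)[OF v] by (simp_all add: eta_graph_sel)
      obtain u where u: "u \<in> verts E" "w \<in> Qs S u" using w(1) unfolding abs_space[OF abs] by blast
      show "w \<in> Qs S v" using u eta_vert[OF abs u] w(2) by simp
    next
      fix w assume w: "w \<in> Qs S v"
      show "w \<in> Qs ?T v"
        unfolding theta_ob_sel(2)[OF v]
        using eta_vert[OF abs v w] abs_in_space(1)[OF abs v w] by (simp add: eta_graph_sel)
    qed
  qed (rule extT(1) ext(1))+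
  have Ss_e: "Ss ?T e = Ss S e" if e: "e \<in> arcs E" for e
  proof (intro equalityI subsetI)
    show "w \<in> Ss S e" if "w \<in> Ss ?T e" for w
      using that eta_arc_mem(2) unfolding theta_Ss_iff[OF rep e] by auto
    show "w \<in> Ss ?T e" if w: "w \<in> Ss S e" for w
      using eta_arc_ex[OF e w] unfolding theta_Ss_iff[OF rep e] by blast
  qed
  have Rs_e: "Rs ?T e = Rs S e" if e: "e \<in> arcs E" for e
  proof (intro equalityI subsetI)
    show "w \<in> Rs S e" if "w \<in> Rs ?T e" for w
      using that eta_arc_mem(4) unfolding theta_Rs_iff[OF rep e] by auto
    show "w \<in> Rs ?T e" if w: "w \<in> Rs S e" for w
    proof -
      obtain q where q: "q \<in> Ss S e" "rho S e q = w"
        using w[folded bij_betw_imp_surj_on[OF abs_bij[OF abs e]]] by (auto elim: imageE)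
      show ?thesis
        using eta_arc_ex[OF e q(1)] q(2) unfolding theta_Rs_iff[OF rep e] by blast
    qed
  qed
  have S: "Ss ?T = Ss S" by (rule extensionalityI[of _ "arcs E"]; (rule extT(2) ext(2) Ss_e | assumption)+)
  have R: "Rs ?T = Rs S" by (rule extensionalityI[of _ "arcs E"]; (rule extT(3) ext(3) Rs_e | assumption)+)
  have rho: "rho ?T = rho S"
  proof (rule extensionalityI[of _ "arcs E"])
    fix e assume e: "e \<in> arcs E"
    show "rho ?T e = rho S e"
    proof (rule extensionalityI[of _ "Ss S e"])
      fix q assume q: "q \<in> Ss S e"
      obtain a where a: "a \<in> arcs (eta_graph S)" "tail (eta_graph S) a = q"
        "head (eta_graph S) a = rho S e q" "snd (eta_map S) a = e" using eta_arc_ex[OF e q] .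
      then show "rho ?T e q = rho S e q" using theta_rho[OF rep a(1)] by simp
    qed (use extT(5)[OF e] ext(5)[OF e] Ss_e[OF e] in simp_all)
  qed (rule extT(4) ext(4))+
  show ?thesis
    using Q S R rho by (intro branching_system.equality) (simp_all add: theta_ob_sel eta_graph_sel)
qed

end

lemma FOb_eta: "FOb (eta E C f) S = (eta_graph S, eta_map S)"
  by (simp add: eta_def eta_ob_eq)

lemma fst_FMor_eta: "fst (FMor (eta E C f) S T \<alpha>) = restrict \<alpha> (space S)"
  by (simp add: eta_def)

lemma snd_FMor_eta:
  assumes "v \<in> verts E" "q \<in> Qs S v" "X \<in> C v"
  shows "snd (FMor (eta E C f) S T \<alpha>) (f q X) = f (\<alpha> q) X"
  using eta_arcsI[of v q S X] assms by (simp add: eta_def eta_decode)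

lemma eta_hom:
  assumes S: "algebraic_branching_system E C D S" and T: "algebraic_branching_system E C D T"
    and \<alpha>: "\<alpha> \<in> Hom (ABS E C D) S T"
  shows "FMor (eta E C f) S T \<alpha> \<in> Hom (RG E C D) (eta_graph S, eta_map S) (eta_graph T, eta_map T)"
proof -
  let ?\<eta> = "FMor (eta E C f) S T \<alpha>"
  have vert: "\<alpha> q \<in> space T \<and> fst (eta_map T) (\<alpha> q) = fst (eta_map S) q" if "q \<in> space S" for q
  proof -
    obtain v where v: "v \<in> verts E" "q \<in> Qs S v" using \<open>q \<in> space S\<close> abs_space[OF S] by auto
    then have "\<alpha> q \<in> Qs T v" using ABS_hom(2)[OF \<alpha>] by simp
    then show ?thesis using v eta_vert[OF S v] eta_vert[OF T] abs_in_space[OF T] by simp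
  qed
  have arc: "snd ?\<eta> a \<in> arcs (eta_graph T) \<and>
      snd (eta_map T) (snd ?\<eta> a) = snd (eta_map S) a \<and>
      tail (eta_graph T) (snd ?\<eta> a) = \<alpha> (tail (eta_graph S) a) \<and>
      head (eta_graph T) (snd ?\<eta> a) = \<alpha> (head (eta_graph S) a)"
    if a: "a \<in> arcs (eta_graph S)" for a
  proof -
    obtain v q X where a: "v \<in> verts E" "q \<in> Qs S v" "X \<in> C v" "a = f q X"
      using a unfolding eta_graph_sel by (rule eta_arcsE)
    note v = a(1-3)
    have v': "v \<in> verts E" "\<alpha> q \<in> Qs T v" "X \<in> C v" using v ABS_hom(2)[OF \<alpha>] by auto
    note l = eta_label[OF S v] and e = eta_label_arc[OF S v]
    have "eta_label T (\<alpha> q) X = eta_label S q X"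
      by (rule eta_label_eq[OF T v(1,3) l(1) ABS_hom(3)[OF \<alpha> e(1) l(2)]])
    then show ?thesis
      using ABS_hom(5)[OF \<alpha> e(1) l(2)]
      by (simp add: a(4) snd_FMor_eta[OF v] eta_arc[OF v] eta_arc[OF v'] eta_graph_sel
          eta_arcsI[OF v'])
  qed
  note rep = eta_ob_rep[OF S]
  have "snd ?\<eta> \<in> extensional (arcs (eta_graph S))" by (simp add: eta_def eta_graph_sel)
  then show ?thesis
    unfolding RG_hom_iff[OF rep] graph_hom_def fst_FMor_eta
    using vert arc rep_verts(2,3)[OF rep] by (auto simp: PiE_iff eta_graph_sel)
qed

lemma is_functor_eta:
  "is_functor (ABS E C D) (RG E C D) (eta E C f)" (is "is_functor ?ABS ?RG ?\<eta>")
proof -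
  have Ob: "X \<in> Ob ?ABS \<longleftrightarrow> algebraic_branching_system E C D X" for X by (simp add: ABS_def)
  have ob: "FOb ?\<eta> S \<in> Ob ?RG" if "algebraic_branching_system E C D S" for S
    using eta_ob_rep[OF that] by (simp add: FOb_eta RG_def)
  have idn: "FMor ?\<eta> S S (Idn ?ABS S) = Idn ?RG (FOb ?\<eta> S)"
    if S: "algebraic_branching_system E C D S" for S
    unfolding FOb_eta
    by (rule RG_hom_eqI[OF eta_ob_rep[OF S] eta_ob_rep[OF S] eta_hom[OF S S ABS_Idn[OF S]]
          RG_Idn[OF eta_ob_rep[OF S]]])
      (simp add: fst_FMor_eta fst_RG_Idn eta_graph_sel ABS_def)
  have comp: "FMor ?\<eta> S U (Comp ?ABS S T U \<beta> \<alpha>) =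
      Comp ?RG (FOb ?\<eta> S) (FOb ?\<eta> T) (FOb ?\<eta> U) (FMor ?\<eta> T U \<beta>) (FMor ?\<eta> S T \<alpha>)"
    if S: "algebraic_branching_system E C D S" and T: "algebraic_branching_system E C D T"
      and U: "algebraic_branching_system E C D U"
      and \<alpha>: "\<alpha> \<in> Hom ?ABS S T" and \<beta>: "\<beta> \<in> Hom ?ABS T U" for S T U \<alpha> \<beta>
    unfolding FOb_eta
  proof (rule RG_hom_eqI[OF eta_ob_rep[OF S] eta_ob_rep[OF U]
        eta_hom[OF S U ABS_Comp[OF S \<alpha> \<beta>]]
        RG_Comp[OF eta_ob_rep[OF S] eta_ob_rep[OF T] eta_hom[OF S T \<alpha>] eta_hom[OF T U \<beta>]]])
    fix w assume w: "w \<in> verts (eta_graph S)"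
    then have "w \<in> space S" by (simp add: eta_graph_sel)
    moreover then have "\<alpha> w \<in> space T" using ABS_hom(1)[OF \<alpha>] by auto
    ultimately show "fst (FMor ?\<eta> S U (Comp ?ABS S T U \<beta> \<alpha>)) w =
        fst (Comp ?RG (eta_graph S, eta_map S) (eta_graph T, eta_map T) (eta_graph U, eta_map U)
          (FMor ?\<eta> T U \<beta>) (FMor ?\<eta> S T \<alpha>)) w"
      by (simp add: fst_FMor_eta fst_RG_Comp[OF w]) (simp add: ABS_def compose_def)
  qed
  show ?thesis
    unfolding is_functor_def Ball_def Ob
    using ob idn comp eta_hom by (simp add: FOb_eta)
qed


section \<open>The equivalence\<close>

lemma theta_eta_eq: "functor_eq_on (ABS E C D) (theta E \<circ>\<^sub>F eta E C f) id_functor"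
proof -
  have "FOb (theta E) (FOb (eta E C f) S) = S" if "S \<in> Ob (ABS E C D)" for S
    using theta_eta_ob that by (simp add: FOb_theta FOb_eta ABS_def)
  moreover have "FMor (theta E) (FOb (eta E C f) S) (FOb (eta E C f) T) (FMor (eta E C f) S T \<alpha>) = \<alpha>"
    if "\<alpha> \<in> Hom (ABS E C D) S T" for S T \<alpha>
    using ABS_hom(1)[OF that]
    by (auto simp: FMor_theta FOb_eta fst_FMor_eta eta_graph_sel PiE_def extensional_restrict)
  ultimately show ?thesis by (simp add: functor_eq_on_def comp_functor_def id_functor_def)
qed

text \<open>Since \<open>\<theta>(\<eta>(\<theta>(F))) = \<theta>(F)\<close>, the identity lifts to an isomorphism \<open>\<eta>(\<theta>(F)) \<rightarrow> F\<close> that is the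
  identity on vertices; naturality, checked on vertices, is then immediate.\<close>

lemma eta_theta_iso:
  "naturally_isomorphic (RG E C D) (RG E C D) (eta E C f \<circ>\<^sub>F theta E) id_functor"
    (is "naturally_isomorphic ?RG _ ?F _")
proof -
  have Ob: "X \<in> Ob ?RG \<longleftrightarrow> representation_graph E C D X" for X by (simp add: RG_def)
  have F: "is_functor ?RG ?RG ?F" by (rule is_functor_comp[OF is_functor_theta is_functor_eta])
  have FOb: "FOb ?F X = (eta_graph (theta_ob E X), eta_map (theta_ob E X))" for X
    by (simp add: comp_functor_def FOb_theta FOb_eta)
  have rep: "representation_graph E C D (FOb ?F X)" if "representation_graph E C D X" for X
    using F that by (simp add: is_functor_def Ob)
  have verts: "verts (eta_graph (theta_ob E (G, \<psi>))) = verts G" for G \<psi>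
    by (simp add: eta_graph_sel theta_ob_sel)
  have "\<exists>t. is_iso ?RG (FOb ?F X) X t \<and> (\<forall>w\<in>verts (fst X). fst t w = w)"
    if X: "representation_graph E C D X" for X
  proof -
    obtain G \<psi> where G: "X = (G, \<psi>)" by (cases X)
    note R = X[unfolded G]
    have "theta_ob E (eta_graph (theta_ob E (G, \<psi>)), eta_map (theta_ob E (G, \<psi>))) = theta_ob E (G, \<psi>)"
      by (rule theta_eta_ob[OF theta_ob_abs[OF R]])
    then obtain t where "is_iso ?RG (FOb ?F (G, \<psi>)) (G, \<psi>) t"
      "\<And>w. w \<in> verts (eta_graph (theta_ob E (G, \<psi>))) \<Longrightarrow> fst t w = w"
      using iso_if_theta_ob_eq[OF rep[OF R, unfolded FOb] R] unfolding FOb by blast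
    then show ?thesis unfolding G verts fst_conv by blast
  qed
  then obtain t where t: "\<And>X. representation_graph E C D X \<Longrightarrow> is_iso ?RG (FOb ?F X) X (t X)"
    "\<And>X w. representation_graph E C D X \<Longrightarrow> w \<in> verts (fst X) \<Longrightarrow> fst (t X) w = w"
    by metis
  have nat: "Comp ?RG (FOb ?F (G, \<psi>)) (FOb ?F (H, \<chi>)) (H, \<chi>) (t (H, \<chi>)) (FMor ?F (G, \<psi>) (H, \<chi>) \<alpha>) =
      Comp ?RG (FOb ?F (G, \<psi>)) (G, \<psi>) (H, \<chi>) \<alpha> (t (G, \<psi>))" (is "?l = ?r")
    if G: "representation_graph E C D (G, \<psi>)" and H: "representation_graph E C D (H, \<chi>)"
      and \<alpha>: "\<alpha> \<in> Hom ?RG (G, \<psi>) (H, \<chi>)" for G \<psi> H \<chi> \<alpha>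
  proof -
    have F\<alpha>: "FMor ?F (G, \<psi>) (H, \<chi>) \<alpha> \<in> Hom ?RG (FOb ?F (G, \<psi>)) (FOb ?F (H, \<chi>))"
      using F \<alpha> iffD2[OF Ob G] iffD2[OF Ob H] unfolding is_functor_def by blast
    have tG: "t (G, \<psi>) \<in> Hom ?RG (FOb ?F (G, \<psi>)) (G, \<psi>)"
      and tH: "t (H, \<chi>) \<in> Hom ?RG (FOb ?F (H, \<chi>)) (H, \<chi>)"
      using t(1)[OF G] t(1)[OF H] by (auto simp: is_iso_def)
    have F\<alpha>_fst: "fst (FMor ?F (G, \<psi>) (H, \<chi>) \<alpha>) w = fst \<alpha> w" if "w \<in> verts G" for w
      using that by (simp add: comp_functor_def fst_FMor_eta FMor_theta FOb_theta theta_ob_sel)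
    note rG = rep[OF G, unfolded FOb] and rH = rep[OF H, unfolded FOb]
    note homs = F\<alpha>[unfolded FOb] tG[unfolded FOb] tH[unfolded FOb]
    show ?thesis
      unfolding FOb
    proof (rule RG_hom_eqI[OF rG H RG_Comp[OF rG rH homs(1,3)] RG_Comp[OF rG G homs(2) \<alpha>]])
      fix w assume w: "w \<in> verts (eta_graph (theta_ob E (G, \<psi>)))"
      then have w': "w \<in> verts G" by (simp add: verts)
      have "fst (t (H, \<chi>)) (fst \<alpha> w) = fst \<alpha> w"
        by (rule t(2)[OF H]) (simp add: RG_hom_verts[OF \<alpha> w'])
      moreover have "fst (t (G, \<psi>)) w = w" by (rule t(2)[OF G]) (simp add: w')
      ultimately show
        "fst (Comp ?RG (eta_graph (theta_ob E (G, \<psi>)), eta_map (theta_ob E (G, \<psi>)))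
            (eta_graph (theta_ob E (H, \<chi>)), eta_map (theta_ob E (H, \<chi>))) (H, \<chi>)
            (t (H, \<chi>)) (FMor ?F (G, \<psi>) (H, \<chi>) \<alpha>)) w =
         fst (Comp ?RG (eta_graph (theta_ob E (G, \<psi>)), eta_map (theta_ob E (G, \<psi>)))
            (G, \<psi>) (H, \<chi>) \<alpha> (t (G, \<psi>))) w"
        unfolding fst_RG_Comp[OF w] by (simp add: F\<alpha>_fst w')
    qed
  qed
  have idO: "FOb id_functor X = X" and idM: "FMor id_functor X Y \<alpha> = \<alpha>" for X Y \<alpha>
    by (simp_all add: id_functor_def)
  show ?thesis
    unfolding naturally_isomorphic_def idO idM Ball_def Ob split_paired_All
    using F is_functor_id t(1) nat by blast
qed

end

theorem mainTheorem4:
  fixes E :: "('v, 'e) pre_digraph"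
    and C D :: "'v \<Rightarrow> 'e set set"
    and f :: "'q \<Rightarrow> 'e set \<Rightarrow> 'f"
  assumes "bi_separated_graph E C D"
    and "edge_symbols E C f"
  shows "is_category (ABS E C D :: (('v, 'e, 'q) branching_system, 'q \<Rightarrow> 'q) cat) \<and>
    is_category (RG E C D :: (('v, 'e, 'q, 'f) rep_graph, ('q, 'f, 'q, 'f) graph_map) cat) \<and>
    is_functor (ABS E C D) (RG E C D) (eta E C f) \<and>
    is_functor (RG E C D) (ABS E C D)
      (theta E :: (('v, 'e, 'q, 'f) rep_graph, ('q, 'f, 'q, 'f) graph_map,
                   ('v, 'e, 'q) branching_system, 'q \<Rightarrow> 'q) cat_functor) \<and>
    functor_eq_on (ABS E C D) (theta E \<circ>\<^sub>F eta E C f) id_functor \<and>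
    naturally_isomorphic (RG E C D) (RG E C D) (eta E C f \<circ>\<^sub>F theta E) id_functor \<and>
    equivalent_categories
      (RG E C D :: (('v, 'e, 'q, 'f) rep_graph, ('q, 'f, 'q, 'f) graph_map) cat)
      (ABS E C D :: (('v, 'e, 'q) branching_system, 'q \<Rightarrow> 'q) cat)"
proof -
  interpret bi_separated_symbols E C D f
    using assms by unfold_locales
  have "naturally_isomorphic (ABS E C D) (ABS E C D) (theta E \<circ>\<^sub>F eta E C f) id_functor"
    by (rule naturally_isomorphic_if_functor_eq_on[OF is_category_ABS
          is_functor_comp[OF is_functor_eta is_functor_theta] is_functor_id theta_eta_eq])
  then show ?thesis
    using is_category_ABS is_category_RG is_functor_eta is_functor_theta theta_eta_eq eta_theta_iso
    unfolding equivalent_categories_def by blast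
qed

end
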